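(* Let $R$ be a ring. Then either $R$ is submaximal, or $R$ is a Hilbert ring with $|\mathrm{Spec}(R)|\leq 2^{2^{\aleph_0}}$.
   Context: All rings are commutative with $1\neq 0$, and a subring of a ring contains the identity of that ring. A maximal subring of $R$ is a proper subring $S\subsetneq R$ such that there is no subring strictly between $S$ and $R$; $R$ is called submaximal if it has at least one maximal subring. An integral domain $D$ is a $G$-domain if its quotient field is finitely generated as a ring over $D$. A prime ideal $P$ of $R$ is a $G$-ideal if $R/P$ is a $G$-domain. $R$ is a Hilbert ring if every $G$-ideal of $R$ is maximal. $\mathrm{Spec}(R)$ is the set of prime ideals of $R$. *)

theory Defs
  imports "HOL-Algebra.Generated_Rings" "HOL-Library.Equipollence"
begin

section \<open>Maximal subrings\<close>

definition maximal_subring :: "'a set \<Rightarrow> ('a, 'b) ring_scheme \<Rightarrow> bool" where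
  "maximal_subring S R \<longleftrightarrow>
     subring S R \<and> S \<subset> carrier R \<and> \<not> (\<exists>T. subring T R \<and> S \<subset> T \<and> T \<subset> carrier R)"

definition submaximal :: "('a, 'b) ring_scheme \<Rightarrow> bool" where
  "submaximal R \<longleftrightarrow> (\<exists>S. maximal_subring S R)"


section \<open>The quotient field of an integral domain\<close>

definition frac_rel :: "('a, 'b) ring_scheme \<Rightarrow> (('a \<times> 'a) \<times> ('a \<times> 'a)) set" where
  "frac_rel D = {((a, s), (b, t)).
     a \<in> carrier D \<and> s \<in> carrier D - {\<zero>\<^bsub>D\<^esub>} \<and> b \<in> carrier D \<and> t \<in> carrier D - {\<zero>\<^bsub>D\<^esub>} \<and>
     a \<otimes>\<^bsub>D\<^esub> t = b \<otimes>\<^bsub>D\<^esub> s}"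

definition fraction :: "('a, 'b) ring_scheme \<Rightarrow> 'a \<Rightarrow> 'a \<Rightarrow> ('a \<times> 'a) set" where
  "fraction D a s = frac_rel D `` {(a, s)}"

text \<open>
  In the operations below the unions range over all representatives; by well-definedness
  (lemmas \<open>quotient_field_add\<close> and \<open>quotient_field_mult\<close>) each is a union of equal sets.
\<close>

definition quotient_field :: "('a, 'b) ring_scheme \<Rightarrow> ('a \<times> 'a) set ring" where
  "quotient_field D =
    \<lparr>carrier = (carrier D \<times> (carrier D - {\<zero>\<^bsub>D\<^esub>})) // frac_rel D,
     mult = (\<lambda>F G. \<Union>{fraction D (a \<otimes>\<^bsub>D\<^esub> b) (s \<otimes>\<^bsub>D\<^esub> t)
               | a s b t. (a, s) \<in> F \<and> (b, t) \<in> G}),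
     one = fraction D \<one>\<^bsub>D\<^esub> \<one>\<^bsub>D\<^esub>,
     zero = fraction D \<zero>\<^bsub>D\<^esub> \<one>\<^bsub>D\<^esub>,
     add = (\<lambda>F G. \<Union>{fraction D (a \<otimes>\<^bsub>D\<^esub> t \<oplus>\<^bsub>D\<^esub> b \<otimes>\<^bsub>D\<^esub> s) (s \<otimes>\<^bsub>D\<^esub> t)
              | a s b t. (a, s) \<in> F \<and> (b, t) \<in> G})\<rparr>"

definition quotient_field_embed :: "('a, 'b) ring_scheme \<Rightarrow> 'a \<Rightarrow> ('a \<times> 'a) set" where
  "quotient_field_embed D a = fraction D a \<one>\<^bsub>D\<^esub>"

context "domain"
begin

abbreviation nz where "nz \<equiv> carrier R - {\<zero>}"

lemma nz_mult: "s \<in> nz \<Longrightarrow> t \<in> nz \<Longrightarrow> s \<otimes> t \<in> nz"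
  using integral by auto

lemma equiv_frac_rel: "equiv (carrier R \<times> nz) (frac_rel R)"
proof (rule equivI)
  show "refl_on (carrier R \<times> nz) (frac_rel R)"
    by (auto simp: refl_on_def frac_rel_def)
  show "frac_rel R \<subseteq> (carrier R \<times> nz) \<times> (carrier R \<times> nz)"
    by (auto simp: frac_rel_def)
  show "sym (frac_rel R)"
    by (auto simp: sym_def frac_rel_def)
  show "trans (frac_rel R)"
  proof (rule transI, clarify)
    fix a s b t c u
    assume 1: "((a, s), (b, t)) \<in> frac_rel R" and 2: "((b, t), (c, u)) \<in> frac_rel R"
    then have c: "a \<in> carrier R" "b \<in> carrier R" "c \<in> carrier R"
      "s \<in> carrier R" "t \<in> carrier R" "u \<in> carrier R" and t: "t \<noteq> \<zero>"
      and e: "a \<otimes> t = b \<otimes> s" "b \<otimes> u = c \<otimes> t"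
      by (auto simp: frac_rel_def)
    have "t \<otimes> (a \<otimes> u) = (a \<otimes> t) \<otimes> u" using c by (simp add: m_ac)
    also have "\<dots> = (b \<otimes> u) \<otimes> s" unfolding e(1) using c by (simp add: m_ac)
    also have "\<dots> = t \<otimes> (c \<otimes> s)" unfolding e(2) using c by (simp add: m_ac)
    finally have "a \<otimes> u = c \<otimes> s"
      using c t m_lcancel[of t "a \<otimes> u" "c \<otimes> s"] by simp
    then show "((a, s), (c, u)) \<in> frac_rel R" using 1 2 by (auto simp: frac_rel_def)
  qed
qed

lemma frac_eq_iff:
  assumes "a \<in> carrier R" "s \<in> nz" "b \<in> carrier R" "t \<in> nz"
  shows "fraction R a s = fraction R b t \<longleftrightarrow> a \<otimes> t = b \<otimes> s"
  using eq_equiv_class_iff[OF equiv_frac_rel, of "(a, s)" "(b, t)"] assms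
  by (auto simp: fraction_def frac_rel_def)

lemma mem_frac_self: "a \<in> carrier R \<Longrightarrow> s \<in> nz \<Longrightarrow> (a, s) \<in> fraction R a s"
  by (auto simp: fraction_def frac_rel_def)

lemma quotient_field_carrier:
  "carrier (quotient_field R) = {fraction R a s | a s. a \<in> carrier R \<and> s \<in> nz}"
  by (auto simp: quotient_field_def quotient_def fraction_def)

lemma frac_closed [simp]:
  "a \<in> carrier R \<Longrightarrow> s \<in> nz \<Longrightarrow> fraction R a s \<in> carrier (quotient_field R)"
  by (auto simp: quotient_field_carrier)

lemma quotient_field_mult:
  assumes "a \<in> carrier R" "s \<in> nz" "b \<in> carrier R" "t \<in> nz"
  shows "fraction R a s \<otimes>\<^bsub>quotient_field R\<^esub> fraction R b t = fraction R (a \<otimes> b) (s \<otimes> t)"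
proof -
  have eq: "fraction R (a' \<otimes> b') (s' \<otimes> t') = fraction R (a \<otimes> b) (s \<otimes> t)"
    if m: "(a', s') \<in> fraction R a s" "(b', t') \<in> fraction R b t" for a' s' b' t'
  proof -
    have c: "a' \<in> carrier R" "s' \<in> nz" "b' \<in> carrier R" "t' \<in> nz"
      and e: "a \<otimes> s' = a' \<otimes> s" "b \<otimes> t' = b' \<otimes> t"
      using m by (auto simp: fraction_def frac_rel_def)
    have "(a' \<otimes> b') \<otimes> (s \<otimes> t) = (a' \<otimes> s) \<otimes> (b' \<otimes> t)"
      using c assms by (simp add: m_ac)
    also have "\<dots> = (a \<otimes> b) \<otimes> (s' \<otimes> t')"
      unfolding e[symmetric] using c assms by (simp add: m_ac)
    finally show ?thesis
      using c assms by (intro frac_eq_iff[THEN iffD2] nz_mult a_closed m_closed) auto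
  qed
  have "(a, s) \<in> fraction R a s" "(b, t) \<in> fraction R b t"
    using assms mem_frac_self by blast+
  then have "{fraction R (a' \<otimes> b') (s' \<otimes> t') | a' s' b' t'. (a', s') \<in> fraction R a s \<and> (b', t') \<in> fraction R b t}
      = {fraction R (a \<otimes> b) (s \<otimes> t)}"
    using eq by blast
  then show ?thesis
    by (simp add: quotient_field_def)
qed

lemma quotient_field_add:
  assumes "a \<in> carrier R" "s \<in> nz" "b \<in> carrier R" "t \<in> nz"
  shows "fraction R a s \<oplus>\<^bsub>quotient_field R\<^esub> fraction R b t = fraction R (a \<otimes> t \<oplus> b \<otimes> s) (s \<otimes> t)"
proof -
  have eq: "fraction R (a' \<otimes> t' \<oplus> b' \<otimes> s') (s' \<otimes> t') = fraction R (a \<otimes> t \<oplus> b \<otimes> s) (s \<otimes> t)"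
    if m: "(a', s') \<in> fraction R a s" "(b', t') \<in> fraction R b t" for a' s' b' t'
  proof -
    have c: "a' \<in> carrier R" "s' \<in> nz" "b' \<in> carrier R" "t' \<in> nz"
      and e: "a \<otimes> s' = a' \<otimes> s" "b \<otimes> t' = b' \<otimes> t"
      using m by (auto simp: fraction_def frac_rel_def)
    have "(a' \<otimes> t' \<oplus> b' \<otimes> s') \<otimes> (s \<otimes> t)
        = (a' \<otimes> s) \<otimes> (t \<otimes> t') \<oplus> (b' \<otimes> t) \<otimes> (s \<otimes> s')"
      using c assms by (simp add: m_ac l_distr r_distr)
    also have "\<dots> = (a \<otimes> t \<oplus> b \<otimes> s) \<otimes> (s' \<otimes> t')"
      unfolding e[symmetric] using c assms by (simp add: m_ac l_distr r_distr)
    finally show ?thesis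
      using c assms by (intro frac_eq_iff[THEN iffD2] nz_mult a_closed m_closed) auto
  qed
  have "(a, s) \<in> fraction R a s" "(b, t) \<in> fraction R b t"
    using assms mem_frac_self by blast+
  then have "{fraction R (a' \<otimes> t' \<oplus> b' \<otimes> s') (s' \<otimes> t') | a' s' b' t'. (a', s') \<in> fraction R a s \<and> (b', t') \<in> fraction R b t}
      = {fraction R (a \<otimes> t \<oplus> b \<otimes> s) (s \<otimes> t)}"
    using eq by blast
  then show ?thesis
    by (simp add: quotient_field_def)
qed

lemma quotient_field_one: "\<one>\<^bsub>quotient_field R\<^esub> = fraction R \<one> \<one>"
  and quotient_field_zero: "\<zero>\<^bsub>quotient_field R\<^esub> = fraction R \<zero> \<one>"
  by (simp_all add: quotient_field_def)

lemmas quotient_field_ops =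
  quotient_field_mult quotient_field_add quotient_field_one quotient_field_zero

lemma field_quotient_field: "field (quotient_field R)"
proof -
  let ?K = "quotient_field R"
  have obt: "\<exists>a s. x = fraction R a s \<and> a \<in> carrier R \<and> s \<in> carrier R \<and> s \<noteq> \<zero>"
    if "x \<in> carrier ?K" for x
    using that by (auto simp: quotient_field_carrier)
  have nzm: "s \<otimes> t \<noteq> \<zero>" if "s \<in> carrier R" "t \<in> carrier R" "s \<noteq> \<zero>" "t \<noteq> \<zero>" for s t
    using that integral by auto
  have ab: "abelian_group ?K"
  proof (rule abelian_groupI)
    fix x assume "x \<in> carrier ?K"
    then obtain a s where x: "x = fraction R a s" "a \<in> carrier R" "s \<in> carrier R" "s \<noteq> \<zero>"
      using obt by blast
    show "\<exists>y\<in>carrier ?K. y \<oplus>\<^bsub>?K\<^esub> x = \<zero>\<^bsub>?K\<^esub>"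
    proof
      show "fraction R (\<ominus> a) s \<in> carrier ?K" using x by simp
      show "fraction R (\<ominus> a) s \<oplus>\<^bsub>?K\<^esub> x = \<zero>\<^bsub>?K\<^esub>"
        using x by (simp add: quotient_field_ops frac_eq_iff nzm l_minus l_neg)
    qed
    show "\<zero>\<^bsub>?K\<^esub> \<oplus>\<^bsub>?K\<^esub> x = x"
      using x by (simp add: quotient_field_ops)
  next
    fix x y assume "x \<in> carrier ?K" "y \<in> carrier ?K"
    obtain a s where x: "x = fraction R a s" "a \<in> carrier R" "s \<in> carrier R" "s \<noteq> \<zero>"
      using obt[OF \<open>x \<in> carrier ?K\<close>] by blast
    obtain b t where y: "y = fraction R b t" "b \<in> carrier R" "t \<in> carrier R" "t \<noteq> \<zero>"
      using obt[OF \<open>y \<in> carrier ?K\<close>] by blast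
    show "x \<oplus>\<^bsub>?K\<^esub> y \<in> carrier ?K"
      using x y by (simp add: quotient_field_ops nzm)
    show "x \<oplus>\<^bsub>?K\<^esub> y = y \<oplus>\<^bsub>?K\<^esub> x"
      using x y by (simp add: quotient_field_ops m_comm a_comm)
    fix z assume "z \<in> carrier ?K"
    obtain c u where z: "z = fraction R c u" "c \<in> carrier R" "u \<in> carrier R" "u \<noteq> \<zero>"
      using obt[OF \<open>z \<in> carrier ?K\<close>] by blast
    show "x \<oplus>\<^bsub>?K\<^esub> y \<oplus>\<^bsub>?K\<^esub> z = x \<oplus>\<^bsub>?K\<^esub> (y \<oplus>\<^bsub>?K\<^esub> z)"
      using x y z by (simp add: quotient_field_ops nzm l_distr r_distr m_ac a_ac)
  next
    show "\<zero>\<^bsub>?K\<^esub> \<in> carrier ?K" by (simp add: quotient_field_ops)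
  qed
  have mon: "comm_monoid ?K"
  proof (rule comm_monoidI)
    show "\<one>\<^bsub>?K\<^esub> \<in> carrier ?K" by (simp add: quotient_field_ops)
  next
    fix x assume "x \<in> carrier ?K"
    then obtain a s where x: "x = fraction R a s" "a \<in> carrier R" "s \<in> carrier R" "s \<noteq> \<zero>"
      using obt by blast
    show "\<one>\<^bsub>?K\<^esub> \<otimes>\<^bsub>?K\<^esub> x = x"
      using x by (simp add: quotient_field_ops)
  next
    fix x y assume "x \<in> carrier ?K" "y \<in> carrier ?K"
    obtain a s where x: "x = fraction R a s" "a \<in> carrier R" "s \<in> carrier R" "s \<noteq> \<zero>"
      using obt[OF \<open>x \<in> carrier ?K\<close>] by blast
    obtain b t where y: "y = fraction R b t" "b \<in> carrier R" "t \<in> carrier R" "t \<noteq> \<zero>"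
      using obt[OF \<open>y \<in> carrier ?K\<close>] by blast
    show "x \<otimes>\<^bsub>?K\<^esub> y \<in> carrier ?K"
      using x y by (simp add: quotient_field_ops nzm)
    show "x \<otimes>\<^bsub>?K\<^esub> y = y \<otimes>\<^bsub>?K\<^esub> x"
      using x y by (simp add: quotient_field_ops m_comm)
    fix z assume "z \<in> carrier ?K"
    obtain c u where z: "z = fraction R c u" "c \<in> carrier R" "u \<in> carrier R" "u \<noteq> \<zero>"
      using obt[OF \<open>z \<in> carrier ?K\<close>] by blast
    show "x \<otimes>\<^bsub>?K\<^esub> y \<otimes>\<^bsub>?K\<^esub> z = x \<otimes>\<^bsub>?K\<^esub> (y \<otimes>\<^bsub>?K\<^esub> z)"
      using x y z by (simp add: quotient_field_ops nzm m_ac)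
  qed
  have cr: "cring ?K"
  proof (rule cringI[OF ab mon])
    fix x y z assume "x \<in> carrier ?K" "y \<in> carrier ?K" "z \<in> carrier ?K"
    obtain a s where x: "x = fraction R a s" "a \<in> carrier R" "s \<in> carrier R" "s \<noteq> \<zero>"
      using obt[OF \<open>x \<in> carrier ?K\<close>] by blast
    obtain b t where y: "y = fraction R b t" "b \<in> carrier R" "t \<in> carrier R" "t \<noteq> \<zero>"
      using obt[OF \<open>y \<in> carrier ?K\<close>] by blast
    obtain c u where z: "z = fraction R c u" "c \<in> carrier R" "u \<in> carrier R" "u \<noteq> \<zero>"
      using obt[OF \<open>z \<in> carrier ?K\<close>] by blast
    show "(x \<oplus>\<^bsub>?K\<^esub> y) \<otimes>\<^bsub>?K\<^esub> z = x \<otimes>\<^bsub>?K\<^esub> z \<oplus>\<^bsub>?K\<^esub> y \<otimes>\<^bsub>?K\<^esub> z"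
      using x y z by (simp add: quotient_field_ops nzm frac_eq_iff l_distr r_distr m_ac)
  qed
  interpret K: cring ?K by (fact cr)
  show ?thesis
  proof (rule K.cring_fieldI2)
    show "\<zero>\<^bsub>?K\<^esub> \<noteq> \<one>\<^bsub>?K\<^esub>"
      by (simp add: quotient_field_ops frac_eq_iff)
    fix x assume "x \<in> carrier ?K" and x0: "x \<noteq> \<zero>\<^bsub>?K\<^esub>"
    then obtain a s where x: "x = fraction R a s" "a \<in> carrier R" "s \<in> carrier R" "s \<noteq> \<zero>"
      using obt by blast
    with x0 have a: "a \<noteq> \<zero>" by (auto simp: quotient_field_ops frac_eq_iff)
    show "\<exists>y\<in>carrier ?K. x \<otimes>\<^bsub>?K\<^esub> y = \<one>\<^bsub>?K\<^esub>"
    proof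
      show "fraction R s a \<in> carrier ?K" using x a by simp
      show "x \<otimes>\<^bsub>?K\<^esub> fraction R s a = \<one>\<^bsub>?K\<^esub>"
        using x a by (simp add: quotient_field_ops frac_eq_iff nzm m_comm)
    qed
  qed
qed

lemma quotient_field_embed_hom: "quotient_field_embed R \<in> ring_hom R (quotient_field R)"
  by (rule ring_hom_memI) (auto simp: quotient_field_embed_def quotient_field_ops)

lemma quotient_field_embed_inj: "inj_on (quotient_field_embed R) (carrier R)"
  by (auto simp: inj_on_def quotient_field_embed_def frac_eq_iff)

lemma frac_mult_embed:
  "a \<in> carrier R \<Longrightarrow> s \<in> nz \<Longrightarrow>
    fraction R a s \<otimes>\<^bsub>quotient_field R\<^esub> quotient_field_embed R s = quotient_field_embed R a"
  by (simp add: quotient_field_embed_def quotient_field_ops frac_eq_iff m_ac)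

end


section \<open>G-domains, G-ideals, Hilbert rings\<close>

definition G_domain :: "('a, 'b) ring_scheme \<Rightarrow> bool" where
  "G_domain D \<longleftrightarrow> domain D \<and>
     (\<exists>A. finite A \<and> A \<subseteq> carrier (quotient_field D) \<and>
          generate_ring (quotient_field D) (quotient_field_embed D ` carrier D \<union> A)
            = carrier (quotient_field D))"

definition G_ideal :: "'a set \<Rightarrow> ('a, 'b) ring_scheme \<Rightarrow> bool" where
  "G_ideal P R \<longleftrightarrow> primeideal P R \<and> G_domain (R Quot P)"

definition Hilbert_ring :: "('a, 'b) ring_scheme \<Rightarrow> bool" where
  "Hilbert_ring R \<longleftrightarrow> (\<forall>P. G_ideal P R \<longrightarrow> maximalideal P R)"

definition Spec :: "('a, 'b) ring_scheme \<Rightarrow> 'a set set" where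
  "Spec R = {P. primeideal P R}"

end

theory Submission
  imports Defs "HOL-Algebra.Polynomial_Divisibility" "HOL-Decision_Procs.Algebra_Aux"
    "HOL-Computational_Algebra.Primes" "HOL-Library.Countable_Set"
begin

text \<open>
  A ring generated by a proper subring and one further element is submaximal, by Zorn's lemma. In a
  domain \<open>R\<close> with a unit \<open>u\<close> this applies as soon as some subring \<open>A\<close> contains \<open>u\<close> as a prime
  element and no nonzero element of \<open>A\<close> is divisible by all powers of \<open>u\<close>: enlarging \<open>A\<close> one makes
  \<open>R\<close> algebraic over \<open>A\<close>, and extending the discrete valuation of \<open>A\<close> given by \<open>u\<close> as in
  Chevalley's theorem yields a subring \<open>S\<close> with \<open>1/u \<notin> S\<close> and \<open>S[1/u] = R\<close>.

  Hence in a domain that is not submaximal, all units are algebraic over the prime ring, and no prime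
  number is a unit if the characteristic is \<open>0\<close>. It follows that a G-domain that is not submaximal is
  a field, so that a ring that is not submaximal is a Hilbert ring, and that a field that is not
  submaximal is countable. If \<open>R\<close> is not submaximal, distinct maximal ideals have
  non-isomorphic residue fields, since otherwise \<open>R\<close> maps onto some \<open>F \<times> F\<close>, in which the
  diagonal is a maximal subring. There are at most continuum many isomorphism types of countable
  fields, and in a Hilbert ring a prime ideal is determined by the maximal ideals above it.
\<close>

section \<open>Rings generated over a subring by one element\<close>

text \<open>The application of Zorn's lemma asks for a single element that generates
  \<open>R\<close> over \<open>S\<close>. A valuation ring obtained from Chevalley's theorem can
  have any rank, and inverting one element \<open>u\<close> then need not give everything. This is
  why the prime is separated and \<open>R\<close> is made algebraic over \<open>A\<close>: a nonzero
  \<open>y\<close> satisfies a relation whose leading coefficient is divisible by only finitely many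
  powers of \<open>u\<close>, and that exponent bounds the power of \<open>u\<close> that moves
  \<open>y\<close> into \<open>S\<close>. As \<open>R\<close> need not be a field, \<open>S\<close>
  is described by a contraction condition inside \<open>R\<close> and not as a valuation ring of a
  quotient field. Separated primes come from two sources: a prime number in a copy of the integers,
  and an element transcendental over a subring, seen in the polynomial ring it generates. In the
  cardinal bound, one exponential counts operation tables of countable fields, the other counts sets
  of maximal ideals.\<close>

lemma (in ring) subring_Union:
  assumes "C \<noteq> {}" and "\<And>A. A \<in> C \<Longrightarrow> subring A R"
    and chain: "\<And>A B. A \<in> C \<Longrightarrow> B \<in> C \<Longrightarrow> A \<subseteq> B \<or> B \<subseteq> A"
  shows "subring (\<Union>C) R"
proof (rule subringI)
  have two: "\<exists>D\<in>C. x \<in> D \<and> y \<in> D" if "x \<in> \<Union>C" "y \<in> \<Union>C" for x y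
    using that chain by (metis UnionE subsetD)
  show "\<Union>C \<subseteq> carrier R" using subringE(1)[OF assms(2)] by blast
  show "\<one> \<in> \<Union>C" using assms(1) subringE(3)[OF assms(2)] by blast
  show "\<ominus> h \<in> \<Union>C" if "h \<in> \<Union>C" for h
    using that subringE(5)[OF assms(2)] by blast
  fix h k assume "h \<in> \<Union>C" "k \<in> \<Union>C"
  then obtain D where "D \<in> C" "h \<in> D" "k \<in> D" using two by blast
  then show "h \<otimes> k \<in> \<Union>C" "h \<oplus> k \<in> \<Union>C"
    using subringE(6,7)[OF assms(2)] by blast+
qed

text \<open>Take \<open>M\<close> maximal among the subrings that contain \<open>S\<close> and miss
  \<open>x\<close>. A strictly larger subring contains \<open>x\<close>, hence is all of
  \<open>R\<close> by \<open>gen\<close>, so nothing fits between \<open>M\<close> and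
  \<open>R\<close>.\<close>

lemma (in ring) submaximal_if_generated:
  assumes S: "subring S R" and x: "x \<in> carrier R" "x \<notin> S"
    and gen: "\<And>T. subring T R \<Longrightarrow> S \<subseteq> T \<Longrightarrow> x \<in> T \<Longrightarrow> T = carrier R"
  shows "submaximal R"
proof -
  let ?F = "{T. subring T R \<and> S \<subseteq> T \<and> x \<notin> T}"
  have "\<exists>M\<in>?F. \<forall>W\<in>?F. M \<subseteq> W \<longrightarrow> W = M"
  proof (rule subset_Zorn_nonempty)
    show "?F \<noteq> {}" using S x by blast
    fix C assume C: "C \<noteq> {}" "subset.chain ?F C"
    have "subring (\<Union>C) R"
    proof (rule subring_Union[OF C(1)])
      show "subring A R" if "A \<in> C" for A using that C(2) by (auto simp: subset_chain_def)
      show "A \<subseteq> B \<or> B \<subseteq> A" if "A \<in> C" "B \<in> C" for A B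
        using that C(2) by (simp add: subset_chain_def)
    qed
    then show "\<Union>C \<in> ?F" using C by (auto simp: subset_chain_def)
  qed
  then obtain M where M: "M \<in> ?F" "\<forall>W\<in>?F. M \<subseteq> W \<longrightarrow> W = M" ..
  have "maximal_subring M R"
    unfolding maximal_subring_def
  proof (intro conjI notI)
    show "subring M R" using M(1) by simp
    show "M \<subset> carrier R" using M(1) x subringE(1)[of M R] by auto
    assume "\<exists>T. subring T R \<and> M \<subset> T \<and> T \<subset> carrier R"
    then obtain T where T: "subring T R" "M \<subset> T" "T \<subset> carrier R" by metis
    then have "S \<subseteq> T" using M(1) by auto
    then have "x \<notin> T" using T gen[of T] by auto
    then show False using T \<open>S \<subseteq> T\<close> M(2) by auto
  qed
  then show ?thesis unfolding submaximal_def by metis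
qed

section \<open>Values of polynomials over a subring, and the ring they form\<close>

context cring
begin

text \<open>
  The set \<open>polys S z n\<close> consists of the values at \<open>z\<close> of the polynomials of degree less than \<open>n\<close>
  with coefficients in \<open>S\<close>.
\<close>

primrec polys :: "'a set \<Rightarrow> 'a \<Rightarrow> nat \<Rightarrow> 'a set" where
  "polys S z 0 = {\<zero>}"
| "polys S z (Suc n) = {a \<oplus> z \<otimes> f | a f. a \<in> S \<and> f \<in> polys S z n}"

declare polys.simps(2) [simp del]

definition adjoin :: "'a set \<Rightarrow> 'a \<Rightarrow> 'a set" where
  "adjoin S z = (\<Union>n. polys S z n)"

lemma subring_mem_carrier: "subring S R \<Longrightarrow> s \<in> S \<Longrightarrow> s \<in> carrier R"
  using subringE(1) by auto

context
  fixes S z assumes S: "subring S R" and z [simp]: "z \<in> carrier R"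
begin

lemmas [simp] = subring_mem_carrier[OF S]

lemma polys_SucI: "a \<in> S \<Longrightarrow> f \<in> polys S z n \<Longrightarrow> a \<oplus> z \<otimes> f \<in> polys S z (Suc n)"
  by (auto simp: polys.simps(2))

lemma polys_Suc_split:
  assumes "f \<in> polys S z (Suc n)"
  obtains a g where "a \<in> S" "g \<in> polys S z n" "f = a \<oplus> z \<otimes> g"
  using assms by (auto simp: polys.simps(2))

lemma polys_carrier [simp]: "f \<in> polys S z n \<Longrightarrow> f \<in> carrier R"
  by (induction n arbitrary: f) (auto elim!: polys_Suc_split)

lemma polys_zero [simp]: "\<zero> \<in> polys S z n"
proof (induction n)
  case (Suc n)
  then show ?case using polys_SucI[of \<zero> \<zero> n] subringE(2)[OF S] by simp
qed simp

lemma polys_const: "a \<in> S \<Longrightarrow> a \<in> polys S z (Suc n)"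
  using polys_SucI[of a \<zero> n] by simp

lemma polys_shift: "f \<in> polys S z n \<Longrightarrow> z \<otimes> f \<in> polys S z (Suc n)"
  using polys_SucI[of \<zero> f n] subringE(2)[OF S] by simp

lemma polys_add: "f \<in> polys S z n \<Longrightarrow> g \<in> polys S z n \<Longrightarrow> f \<oplus> g \<in> polys S z n"
proof (induction n arbitrary: f g)
  case (Suc n)
  obtain a f' where f: "a \<in> S" "f' \<in> polys S z n" "f = a \<oplus> z \<otimes> f'"
    using polys_Suc_split[OF Suc.prems(1)] .
  obtain b g' where g: "b \<in> S" "g' \<in> polys S z n" "g = b \<oplus> z \<otimes> g'"
    using polys_Suc_split[OF Suc.prems(2)] .
  have "a \<in> carrier R" "f' \<in> carrier R" "b \<in> carrier R" "g' \<in> carrier R" using f g by simp_all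
  then have "f \<oplus> g = (a \<oplus> b) \<oplus> z \<otimes> (f' \<oplus> g')" unfolding f g using z by algebra
  then show ?case using f g Suc.IH subringE(7)[OF S] polys_SucI by simp
qed simp

lemma polys_smult: "s \<in> S \<Longrightarrow> f \<in> polys S z n \<Longrightarrow> s \<otimes> f \<in> polys S z n"
proof (induction n arbitrary: f)
  case (Suc n)
  obtain a f' where f: "a \<in> S" "f' \<in> polys S z n" "f = a \<oplus> z \<otimes> f'"
    using polys_Suc_split[OF Suc.prems(2)] .
  have "s \<in> carrier R" "a \<in> carrier R" "f' \<in> carrier R" using f Suc.prems by simp_all
  then have "s \<otimes> f = s \<otimes> a \<oplus> z \<otimes> (s \<otimes> f')" unfolding f using z by algebra
  then show ?case using f Suc subringE(6)[OF S] polys_SucI by simp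
qed auto

lemma polys_uminus: "f \<in> polys S z n \<Longrightarrow> \<ominus> f \<in> polys S z n"
  using polys_smult[of "\<ominus> \<one>" f n] subringE(3,5)[OF S] by (simp add: l_minus)

lemma polys_minus: "f \<in> polys S z n \<Longrightarrow> g \<in> polys S z n \<Longrightarrow> f \<ominus> g \<in> polys S z n"
  unfolding a_minus_def by (intro polys_add polys_uminus)

lemma polys_Suc_mono: "f \<in> polys S z n \<Longrightarrow> f \<in> polys S z (Suc n)"
proof (induction n arbitrary: f)
  case 0
  then show ?case using polys_zero[of "Suc 0"] by simp
next
  case (Suc n)
  obtain a g where "a \<in> S" "g \<in> polys S z n" "f = a \<oplus> z \<otimes> g"
    using polys_Suc_split[OF Suc.prems] .
  then show ?case using Suc.IH polys_SucI by simp
qed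

lemma polys_mono: "m \<le> n \<Longrightarrow> f \<in> polys S z m \<Longrightarrow> f \<in> polys S z n"
  by (induction n rule: dec_induct) (auto intro: polys_Suc_mono)

lemma polys_monom: "b \<in> S \<Longrightarrow> k < n \<Longrightarrow> b \<otimes> z [^] k \<in> polys S z n"
proof (induction n arbitrary: k)
  case (Suc n)
  show ?case
  proof (cases k)
    case 0 then show ?thesis using Suc polys_const by simp
  next
    case (Suc j)
    have "b \<in> carrier R" using \<open>b \<in> S\<close> by simp
    then have "b \<otimes> z [^] k = z \<otimes> (b \<otimes> z [^] j)" using z unfolding Suc by (simp add: m_ac)
    then show ?thesis using Suc Suc.IH[of j] Suc.prems polys_shift by simp
  qed
qed simp

text \<open>The recursion of \<open>polys\<close> splits off the constant term; here the term of
  highest degree is split off. Chevalley's argument works at both ends of a polynomial.\<close>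

lemma polys_SucE:
  assumes "f \<in> polys S z (Suc n)"
  obtains g b where "g \<in> polys S z n" "b \<in> S" "f = g \<oplus> b \<otimes> z [^] n"
  using assms
proof (induction n arbitrary: f thesis)
  case 0
  then obtain a where a: "a \<in> S" "f = a" by (auto elim: polys_Suc_split)
  then have "f = \<zero> \<oplus> a \<otimes> z [^] (0::nat)" by simp
  then show ?case using 0(1)[of \<zero> a] a by simp
next
  case (Suc n)
  obtain a f' where f: "f = a \<oplus> z \<otimes> f'" "a \<in> S" "f' \<in> polys S z (Suc n)"
    using polys_Suc_split[OF Suc.prems(2)] by blast
  from Suc.IH[OF _ f(3)] obtain g b where g: "g \<in> polys S z n" "b \<in> S" "f' = g \<oplus> b \<otimes> z [^] n" by blast
  have "a \<in> carrier R" "b \<in> carrier R" "g \<in> carrier R" "z [^] n \<in> carrier R" using f g by simp_all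
  then have "f = (a \<oplus> z \<otimes> g) \<oplus> b \<otimes> z [^] Suc n"
    unfolding f(1) g(3) nat_pow_Suc using z by algebra
  moreover have "a \<oplus> z \<otimes> g \<in> polys S z (Suc n)" using f g polys_SucI by simp
  ultimately show ?case using Suc.prems(1) g by blast
qed

lemma polys_mult: "f \<in> polys S z m \<Longrightarrow> g \<in> polys S z n \<Longrightarrow> f \<otimes> g \<in> polys S z (m + n)"
proof (induction m arbitrary: f)
  case (Suc m)
  obtain a f' where f: "f = a \<oplus> z \<otimes> f'" "a \<in> S" "f' \<in> polys S z m"
    using polys_Suc_split[OF Suc.prems(1)] by blast
  have "f \<otimes> g = a \<otimes> g \<oplus> z \<otimes> (f' \<otimes> g)"
    using f(2) subring_mem_carrier polys_carrier[OF f(3)] polys_carrier[OF Suc.prems(2)] z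
    unfolding f by (simp add: l_distr m_assoc)
  moreover have "a \<otimes> g \<in> polys S z (Suc m + n)"
    by (rule polys_mono[of n]) (use polys_smult f Suc.prems in auto)
  moreover have "z \<otimes> (f' \<otimes> g) \<in> polys S z (Suc m + n)"
    using polys_shift[OF Suc.IH[OF f(3) Suc.prems(2)]] by simp
  ultimately show ?case using polys_add by simp
qed auto

lemma polys_subset_adjoin: "f \<in> polys S z n \<Longrightarrow> f \<in> adjoin S z"
  unfolding adjoin_def by blast

lemma subset_adjoin: "S \<subseteq> adjoin S z"
  using polys_subset_adjoin[OF polys_const] by (rule subsetI)

lemma mem_adjoin: "z \<in> adjoin S z"
  using polys_monom[of \<one> 1 2] subringE(3)[OF S] polys_subset_adjoin[of z 2] by simp

lemma subring_adjoin: "subring (adjoin S z) R"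
proof (rule subringI)
  show "adjoin S z \<subseteq> carrier R" unfolding adjoin_def by auto
  show "\<one> \<in> adjoin S z" using subset_adjoin subringE(3)[OF S] by blast
  show "\<ominus> f \<in> adjoin S z" if "f \<in> adjoin S z" for f
    using that polys_uminus[of f] unfolding adjoin_def by auto
  show "f \<otimes> g \<in> adjoin S z" if fg: "f \<in> adjoin S z" "g \<in> adjoin S z" for f g
  proof -
    obtain m n where "f \<in> polys S z m" "g \<in> polys S z n" using fg unfolding adjoin_def by auto
    then show ?thesis using polys_mult polys_subset_adjoin by blast
  qed
  show "f \<oplus> g \<in> adjoin S z" if fg: "f \<in> adjoin S z" "g \<in> adjoin S z" for f g
  proof -
    obtain m n where "f \<in> polys S z m" "g \<in> polys S z n" using fg unfolding adjoin_def by auto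
    then have "f \<in> polys S z (max m n)" "g \<in> polys S z (max m n)"
      using polys_mono[of m "max m n" f] polys_mono[of n "max m n" g] by simp_all
    then show ?thesis using polys_add polys_subset_adjoin by blast
  qed
qed

lemma adjoinE:
  assumes "f \<in> adjoin S z"
  obtains a g where "a \<in> S" "g \<in> adjoin S z" "f = a \<oplus> z \<otimes> g"
proof -
  obtain n where "f \<in> polys S z n" using assms unfolding adjoin_def by auto
  then have "f \<in> polys S z (Suc n)" by (rule polys_Suc_mono)
  then obtain a g where "a \<in> S" "g \<in> polys S z n" "f = a \<oplus> z \<otimes> g"
    using polys_Suc_split[of f n] by metis
  then show ?thesis using that[of a g] polys_subset_adjoin by simp
qed

end

end

section \<open>Subrings with a separated prime element\<close>

context cring
begin

definition multiples :: "'a \<Rightarrow> 'a set \<Rightarrow> 'a set" where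
  "multiples u A = (\<lambda>a. u \<otimes> a) ` A"

text \<open>In a domain these conditions make the largest \<open>k\<close> with \<open>x\<close> in
  \<open>multiples (u [^] k) A\<close> a discrete valuation on the nonzero elements of
  \<open>A\<close>: primality gives additivity, the last clause finiteness. Divisibility is meant in
  \<open>A\<close>; in \<open>R\<close> the element \<open>u\<close> may well be a unit.\<close>

definition separated_prime :: "'a \<Rightarrow> 'a set \<Rightarrow> bool" where
  "separated_prime u A \<longleftrightarrow>
     subring A R \<and> u \<in> A \<and> u \<noteq> \<zero> \<and> \<one> \<notin> multiples u A \<and>
     (\<forall>x\<in>A. \<forall>y\<in>A. x \<otimes> y \<in> multiples u A \<longrightarrow> x \<in> multiples u A \<or> y \<in> multiples u A) \<and>
     (\<forall>x\<in>A. (\<forall>k::nat. x \<in> multiples (u [^] k) A) \<longrightarrow> x = \<zero>)"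

lemma separated_primeD:
  assumes "separated_prime u A"
  shows "subring A R" "u \<in> A" "u \<noteq> \<zero>" "\<one> \<notin> multiples u A"
    "\<And>x y. x \<in> A \<Longrightarrow> y \<in> A \<Longrightarrow> x \<otimes> y \<in> multiples u A \<Longrightarrow> x \<in> multiples u A \<or> y \<in> multiples u A"
    "\<And>x. x \<in> A \<Longrightarrow> (\<And>k::nat. x \<in> multiples (u [^] k) A) \<Longrightarrow> x = \<zero>"
  using assms unfolding separated_prime_def by metis+

text \<open>Algebraic dependence expressed by values only: \<open>b\<close> is the leading
  coefficient, and the lower terms are collected, sign included, in \<open>polys A y n\<close>. Over
  a subring \<open>n = 0\<close> cannot occur, because \<open>polys A y 0\<close> contains only
  zero.\<close>

definition root_over :: "'a set \<Rightarrow> 'a \<Rightarrow> bool" where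
  "root_over A y \<longleftrightarrow> (\<exists>n. \<exists>b\<in>A. b \<noteq> \<zero> \<and> b \<otimes> y [^] n \<in> polys A y n)"

lemma multiplesI: "a \<in> A \<Longrightarrow> u \<otimes> a \<in> multiples u A"
  unfolding multiples_def by (rule imageI)

lemma multiplesE:
  assumes "x \<in> multiples u A" obtains a where "a \<in> A" "x = u \<otimes> a"
  using assms unfolding multiples_def by auto

lemma multiples_mono: "A \<subseteq> B \<Longrightarrow> multiples u A \<subseteq> multiples u B"
  unfolding multiples_def by (rule image_mono)

lemma polys_subset:
  assumes "A \<subseteq> S"
  shows "f \<in> polys A z n \<Longrightarrow> f \<in> polys S z n"
proof (induction n arbitrary: f)
  case (Suc n)
  obtain a g where *: "a \<in> A" "g \<in> polys A z n" "f = a \<oplus> z \<otimes> g"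
    using Suc.prems by (auto simp: polys.simps(2))
  then have "a \<in> S" "g \<in> polys S z n" using assms Suc.IH by auto
  then show ?case unfolding * by (auto simp: polys.simps(2))
qed simp

lemma subring_nat_pow: "subring S R \<Longrightarrow> x \<in> S \<Longrightarrow> x [^] (n::nat) \<in> S"
  by (induction n) (simp_all add: subringE)

lemma subring_minus: "subring S R \<Longrightarrow> x \<in> S \<Longrightarrow> y \<in> S \<Longrightarrow> x \<ominus> y \<in> S"
  by (simp add: a_minus_def subringE)

lemma multiples_add:
  assumes "subring A R" "u \<in> carrier R" "x \<in> multiples u A" "y \<in> multiples u A"
  shows "x \<oplus> y \<in> multiples u A"
proof -
  obtain a b where *: "a \<in> A" "b \<in> A" "x = u \<otimes> a" "y = u \<otimes> b"
    using assms(3,4) unfolding multiples_def by auto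
  then have "x \<oplus> y = u \<otimes> (a \<oplus> b)"
    using assms(2) subringE(1)[OF assms(1)] by (simp add: r_distr subset_iff)
  then show ?thesis using * subringE(7)[OF assms(1)] multiplesI by simp
qed

lemma multiples_mult:
  assumes "subring A R" "u \<in> carrier R" "x \<in> multiples u A" "b \<in> A"
  shows "b \<otimes> x \<in> multiples u A"
proof -
  obtain a where *: "a \<in> A" "x = u \<otimes> a"
    using assms(3) by (rule multiplesE)
  then have "b \<otimes> x = u \<otimes> (b \<otimes> a)"
    using assms(2,4) subringE(1)[OF assms(1)] by (simp add: m_ac subset_iff)
  then show ?thesis using * assms(4) subringE(6)[OF assms(1)] multiplesI by simp
qed

lemma multiples_minus:
  assumes "subring A R" "u \<in> carrier R" "x \<in> multiples u A" "y \<in> multiples u A"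
  shows "x \<ominus> y \<in> multiples u A"
proof -
  have "\<ominus> \<one> \<in> A" using subringE(3,5)[OF assms(1)] by simp
  moreover have "y \<in> carrier R"
    using assms(4,2) subringE(1)[OF assms(1)] unfolding multiples_def by auto
  ultimately have "\<ominus> y \<in> multiples u A"
    using multiples_mult[OF assms(1,2,4)] by (fastforce simp: l_minus)
  then show ?thesis using multiples_add[OF assms(1-3)] by (simp add: a_minus_def)
qed

lemma multiples_zero:
  assumes A: "subring A R" and u: "u \<in> carrier R"
  shows "\<zero> \<in> multiples u A"
  using multiplesI[OF subringE(2)[OF A], of u] u by simp

text \<open>A term \<open>a y^i\<close> with \<open>i < m\<close>, multiplied by \<open>v^m\<close>,
  is \<open>v\<close> times \<open>(v^(m-1-i) a) (v y)^i\<close>. The factor \<open>v\<close> in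
  front survives because the degree is strictly below \<open>m\<close>; it later supplies the
  divisibility by \<open>u\<close>.\<close>

lemma polys_scale:
  assumes A: "subring A R" and v: "v \<in> A" and y: "y \<in> carrier R"
  shows "f \<in> polys A y m \<Longrightarrow> \<exists>g \<in> polys A (v \<otimes> y) m. v [^] m \<otimes> f = v \<otimes> g"
proof (induction m arbitrary: f)
  case 0
  have "v \<in> carrier R" using subring_mem_carrier[OF A v] .
  then show ?case using 0 by simp
next
  case (Suc m)
  have c: "v \<in> carrier R" "v [^] m \<in> carrier R" using subring_mem_carrier[OF A v] by simp_all
  obtain a f' where f: "a \<in> A" "f' \<in> polys A y m" "f = a \<oplus> y \<otimes> f'"
    using polys_Suc_split[OF A y Suc.prems] .
  obtain g' where g: "g' \<in> polys A (v \<otimes> y) m" "v [^] m \<otimes> f' = v \<otimes> g'" using Suc.IH[OF f(2)] ..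
  have c': "a \<in> carrier R" "f' \<in> carrier R" "g' \<in> carrier R"
    using subring_mem_carrier[OF A f(1)] polys_carrier[OF A y f(2)]
      polys_carrier[OF A m_closed[OF c(1) y] g(1)] by simp_all
  have "v [^] Suc m \<otimes> f = v \<otimes> (v [^] m \<otimes> a \<oplus> y \<otimes> (v [^] m \<otimes> f'))"
    unfolding f nat_pow_Suc using c c' y by algebra
  also have "\<dots> = v \<otimes> (v [^] m \<otimes> a \<oplus> (v \<otimes> y) \<otimes> g')"
    unfolding g using c c' y by algebra
  finally show ?case
    using polys_SucI[OF A m_closed[OF c(1) y] subringE(6)[OF A subring_nat_pow[OF A v] f(1)] g(1)]
    by metis
qed

end

section \<open>Adjoining a transcendental element to a ring with a separated prime\<close>

context "domain"
begin

context
  fixes A y assumes A: "subring A R" and y: "y \<in> carrier R" and trans: "\<not> root_over A y"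
begin

lemma transcendental_nonzero: "y \<noteq> \<zero>"
proof
  assume "y = \<zero>"
  then have "\<one> \<otimes> y [^] (1::nat) \<in> polys A y 1" using polys_zero[OF A y, of 1] by simp
  then show False using trans subringE(3)[OF A] unfolding root_over_def by (metis one_not_zero)
qed

text \<open>Strip terms from the top: a nonzero leading coefficient would make \<open>y\<close>
  algebraic over \<open>A\<close>, so each one vanishes until only the constant is left.\<close>

lemma transcendental_const_eq_zero:
  "f \<in> polys A y n \<Longrightarrow> a \<in> A \<Longrightarrow> a \<oplus> y \<otimes> f = \<zero> \<Longrightarrow> a = \<zero>"
proof (induction n arbitrary: f)
  case 0
  then show ?case using y subring_mem_carrier[OF A] by simp
next
  case (Suc n)
  obtain g b where g: "g \<in> polys A y n" "b \<in> A" "f = g \<oplus> b \<otimes> y [^] n"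
    using polys_SucE[OF A y Suc.prems(1)] .
  have c: "a \<in> carrier R" "b \<in> carrier R" "g \<in> carrier R" "y [^] n \<in> carrier R"
    using g Suc.prems y polys_carrier[OF A y] subring_mem_carrier[OF A] by simp_all
  have "(a \<oplus> y \<otimes> g) \<oplus> b \<otimes> y [^] Suc n = \<zero>"
    using Suc.prems(3) c y unfolding g nat_pow_Suc by algebra
  then have eq: "b \<otimes> y [^] Suc n = \<ominus> (a \<oplus> y \<otimes> g)"
    using c y by (metis a_closed m_closed nat_pow_closed minus_equality a_comm)
  then have "b \<otimes> y [^] Suc n \<in> polys A y (Suc n)"
    using polys_uminus[OF A y polys_SucI[OF A y Suc.prems(2) g(1)]] by simp
  then have b: "b = \<zero>" using trans g(2) unfolding root_over_def by metis
  then have "f = g" using g(3) c by simp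
  then show ?case using Suc.IH[OF g(1) Suc.prems(2)] Suc.prems(3) by simp
qed

text \<open>This lets \<open>adjoin A y\<close> be treated as a polynomial ring over
  \<open>A\<close>, by comparison of coefficients.\<close>

lemma transcendental_unique:
  assumes a: "a \<in> A" "b \<in> A" and f: "f \<in> adjoin A y" "g \<in> adjoin A y"
    and eq: "a \<oplus> y \<otimes> f = b \<oplus> y \<otimes> g"
  shows "a = b \<and> f = g"
proof -
  have c: "a \<in> carrier R" "b \<in> carrier R" "f \<in> carrier R" "g \<in> carrier R"
    using a f subring_mem_carrier[OF A] subring_mem_carrier[OF subring_adjoin[OF A y]] by simp_all
  have "(a \<ominus> b) \<oplus> y \<otimes> (f \<ominus> g) = (a \<oplus> y \<otimes> f) \<ominus> (b \<oplus> y \<otimes> g)" using c y by algebra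
  also have "\<dots> = \<zero>" unfolding eq using c y by algebra
  finally have *: "(a \<ominus> b) \<oplus> y \<otimes> (f \<ominus> g) = \<zero>" .
  have "f \<ominus> g \<in> adjoin A y" using subring_minus[OF subring_adjoin[OF A y] f] .
  then obtain n where "f \<ominus> g \<in> polys A y n" unfolding adjoin_def by auto
  then have ab: "a \<ominus> b = \<zero>" using transcendental_const_eq_zero * subring_minus[OF A a] by simp
  then have "y \<otimes> (f \<ominus> g) = \<zero>" using *[unfolded ab] c y by simp
  then have "f \<ominus> g = \<zero>" using integral[of y "f \<ominus> g"] transcendental_nonzero y c by simp
  then show ?thesis using ab c by simp
qed

text \<open>Compare coefficients in a product with the constant \<open>v\<close>. Handling one
  coefficient and leaving the rest to \<open>g\<close> is the form that inductions over
  \<open>polys\<close> need.\<close>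

lemma adjoin_multiples:
  assumes v: "v \<in> A" and a: "a \<in> A" and g: "g \<in> adjoin A y"
  shows "a \<oplus> y \<otimes> g \<in> multiples v (adjoin A y) \<longleftrightarrow> a \<in> multiples v A \<and> g \<in> multiples v (adjoin A y)"
proof
  let ?B = "adjoin A y"
  note cA = subring_mem_carrier[OF A] and cB = subring_mem_carrier[OF subring_adjoin[OF A y]]
  {
    assume "a \<oplus> y \<otimes> g \<in> multiples v ?B"
    then obtain f where f: "f \<in> ?B" "a \<oplus> y \<otimes> g = v \<otimes> f" by (rule multiplesE)
    obtain c h where h: "c \<in> A" "h \<in> ?B" "f = c \<oplus> y \<otimes> h" using adjoinE[OF A y f(1)] .
    have "v \<otimes> f = v \<otimes> c \<oplus> y \<otimes> (v \<otimes> h)"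
      using cA[OF v] cA[OF h(1)] cB[OF h(2)] y unfolding h(3) by algebra
    moreover have "v \<otimes> c \<in> A" using subringE(6)[OF A v h(1)] .
    moreover have "v \<otimes> h \<in> ?B"
      using subringE(6)[OF subring_adjoin[OF A y]] subset_adjoin[OF A y] v h(2) by auto
    ultimately have "a = v \<otimes> c \<and> g = v \<otimes> h" using transcendental_unique[OF a _ g] f(2) by simp
    then show "a \<in> multiples v A \<and> g \<in> multiples v ?B" using h multiplesI by simp
  next
    assume "a \<in> multiples v A \<and> g \<in> multiples v ?B"
    then have "a \<in> multiples v ?B" "g \<in> multiples v ?B"
      using multiples_mono[OF subset_adjoin[OF A y]] by auto
    then show "a \<oplus> y \<otimes> g \<in> multiples v ?B"
      using multiples_add[OF subring_adjoin[OF A y] cA[OF v]]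
        multiples_mult[OF subring_adjoin[OF A y] cA[OF v] _ mem_adjoin[OF A y]] by simp
  }
qed

lemma adjoin_contraction: "v \<in> A \<Longrightarrow> A \<inter> multiples v (adjoin A y) \<subseteq> multiples v A"
proof
  fix x assume v: "v \<in> A" and x: "x \<in> A \<inter> multiples v (adjoin A y)"
  show "x \<in> multiples v A"
    using adjoin_multiples[OF v, of x \<zero>] x y subringE(2)[OF subring_adjoin[OF A y]]
      subring_mem_carrier[OF A] by simp
qed

text \<open>Primality is Gauss's lemma, by induction on the total number of coefficients of the two
  factors. Separation is inherited because divisibility by a power of \<open>u\<close> is tested on
  each coefficient.\<close>

lemma separated_prime_adjoin:
  assumes u: "separated_prime u A"
  shows "separated_prime u (adjoin A y)"
proof -
  let ?B = "adjoin A y"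
  note B = subring_adjoin[OF A y] and D = separated_primeD[OF u]
  note cA = subring_mem_carrier[OF A] and cB = subring_mem_carrier[OF B]
  have uc: "u \<in> carrier R" by (rule cA[OF D(2)])
  have prime: "f \<in> multiples u ?B \<or> g \<in> multiples u ?B"
    if "f \<in> polys A y m" "g \<in> polys A y n" "f \<otimes> g \<in> multiples u ?B" for f g m n
    using that
  proof (induction "m + n" arbitrary: m n f g rule: less_induct)
    case less
    show ?case
    proof (cases "m = 0 \<or> n = 0")
      case True
      then have "f = \<zero> \<or> g = \<zero>" using less.prems by auto
      then show ?thesis using multiples_zero[OF B uc] by auto
    next
      case False
      then obtain m' n' where mn: "m = Suc m'" "n = Suc n'" by (metis nat.exhaust)
      obtain a f' where f: "a \<in> A" "f' \<in> polys A y m'" "f = a \<oplus> y \<otimes> f'"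
        using polys_Suc_split[OF A y less.prems(1)[unfolded mn]] .
      obtain b g' where g: "b \<in> A" "g' \<in> polys A y n'" "g = b \<oplus> y \<otimes> g'"
        using polys_Suc_split[OF A y less.prems(2)[unfolded mn]] .
      note inB = polys_subset_adjoin[OF A y]
      have ab: "a \<in> ?B" "b \<in> ?B" using f g subset_adjoin[OF A y] by auto
      have fgB: "f \<in> ?B" "g \<in> ?B" "f' \<in> ?B" "g' \<in> ?B" using less.prems f g inB by metis+
      have c: "a \<in> carrier R" "b \<in> carrier R" "f' \<in> carrier R" "g' \<in> carrier R"
        "f \<in> carrier R" "g \<in> carrier R"
        using f(1) g(1) fgB cA cB by simp_all
      have 1: "f \<otimes> g = a \<otimes> b \<oplus> y \<otimes> (a \<otimes> g' \<oplus> f' \<otimes> g)"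
        using c y unfolding f(3) g(3) by algebra
      have 2: "f \<otimes> g = a \<otimes> b \<oplus> y \<otimes> (b \<otimes> f' \<oplus> f \<otimes> g')"
        using c y unfolding f(3) g(3) by algebra
      have abA: "a \<otimes> b \<in> A" using subringE(6)[OF A] f g by simp
      have inB1: "a \<otimes> g' \<oplus> f' \<otimes> g \<in> ?B" "b \<otimes> f' \<oplus> f \<otimes> g' \<in> ?B"
        using subringE(6,7)[OF B] ab fgB by simp_all
      have "a \<otimes> b \<in> multiples u A" and m1: "a \<otimes> g' \<oplus> f' \<otimes> g \<in> multiples u ?B"
        using adjoin_multiples[OF D(2) abA inB1(1)] less.prems(3) 1 by simp_all
      have m2: "b \<otimes> f' \<oplus> f \<otimes> g' \<in> multiples u ?B"
        using adjoin_multiples[OF D(2) abA inB1(2)] less.prems(3) 2 by simp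
      \<comment> \<open>The prime divides one of the two constant terms. Subtracting the
        contribution of that term from the non-constant part of the product leaves a product in
        which one factor has lost a coefficient.\<close>
      from \<open>a \<otimes> b \<in> multiples u A\<close> consider "a \<in> multiples u A" | "b \<in> multiples u A"
        using D(5) f g by metis
      then show ?thesis
      proof cases
        case 1
        then have "g' \<otimes> a \<in> multiples u ?B"
          using multiples_mult[OF B uc _ fgB(4)] multiples_mono[OF subset_adjoin[OF A y]] by auto
        then have "(a \<otimes> g' \<oplus> f' \<otimes> g) \<ominus> g' \<otimes> a \<in> multiples u ?B"
          using multiples_minus[OF B uc m1] by simp
        moreover have "(a \<otimes> g' \<oplus> f' \<otimes> g) \<ominus> g' \<otimes> a = f' \<otimes> g" using c by algebra
        ultimately have "f' \<otimes> g \<in> multiples u ?B" by simp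
        then have "f' \<in> multiples u ?B \<or> g \<in> multiples u ?B"
          using less.hyps[of m' n f' g] f(2) less.prems(2) mn by simp
        then show ?thesis
          using adjoin_multiples[OF D(2) f(1) fgB(3)] 1 unfolding f(3)[symmetric] by auto
      next
        case 2
        then have "f' \<otimes> b \<in> multiples u ?B"
          using multiples_mult[OF B uc _ fgB(3)] multiples_mono[OF subset_adjoin[OF A y]] by auto
        then have "(b \<otimes> f' \<oplus> f \<otimes> g') \<ominus> f' \<otimes> b \<in> multiples u ?B"
          using multiples_minus[OF B uc m2] by simp
        moreover have "(b \<otimes> f' \<oplus> f \<otimes> g') \<ominus> f' \<otimes> b = f \<otimes> g'" using c by algebra
        ultimately have "f \<otimes> g' \<in> multiples u ?B" by simp
        then have "f \<in> multiples u ?B \<or> g' \<in> multiples u ?B"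
          using less.hyps[of m n' f g'] g(2) less.prems(1) mn by simp
        then show ?thesis
          using adjoin_multiples[OF D(2) g(1) fgB(4)] 2 unfolding g(3)[symmetric] by auto
      qed
    qed
  qed
  have sep: "f = \<zero>" if "f \<in> polys A y n" "\<And>k::nat. f \<in> multiples (u [^] k) ?B" for f n
    using that
  proof (induction n arbitrary: f)
    case (Suc n)
    obtain a g where f: "a \<in> A" "g \<in> polys A y n" "f = a \<oplus> y \<otimes> g"
      using polys_Suc_split[OF A y Suc.prems(1)] .
    have "a \<in> multiples (u [^] k) A \<and> g \<in> multiples (u [^] k) ?B" for k :: nat
      using adjoin_multiples[OF subring_nat_pow[OF A D(2)] f(1) polys_subset_adjoin[OF A y f(2)]]
        Suc.prems(2) f(3) by simp
    then have "a = \<zero>" "g = \<zero>" using D(6)[OF f(1)] Suc.IH[OF f(2)] by simp_all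
    then show ?case using f(3) y by simp
  qed simp
  have one: "\<one> \<notin> multiples u ?B"
    using adjoin_contraction[OF D(2)] subringE(3)[OF A] D(4) by auto
  have uB: "u \<in> ?B" using subset_adjoin[OF A y] D(2) by auto
  show ?thesis
    unfolding separated_prime_def
  proof (intro conjI ballI impI B uB one D(3))
    fix f g assume "f \<in> ?B" "g \<in> ?B" and fg: "f \<otimes> g \<in> multiples u ?B"
    then obtain m n where "f \<in> polys A y m" "g \<in> polys A y n" unfolding adjoin_def by auto
    then show "f \<in> multiples u ?B \<or> g \<in> multiples u ?B" using prime fg by metis
  next
    fix f assume "f \<in> ?B" and f: "\<forall>k::nat. f \<in> multiples (u [^] k) ?B"
    then obtain n where "f \<in> polys A y n" unfolding adjoin_def by auto
    then show "f = \<zero>" using sep f by metis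
  qed
qed

end

text \<open>Zorn's lemma for an order finer than inclusion: \<open>B\<close> lies above
  \<open>A\<close> only if \<open>u\<close> divides no further element of \<open>A\<close> inside
  \<open>B\<close>. Unions of chains in this order keep \<open>u\<close> a nonunit, prime and
  separated. Adjoining a transcendental element is a proper step up, so a maximal \<open>A\<close>
  leaves none.\<close>

lemma exists_algebraic_separated_prime:
  assumes u: "separated_prime u A0"
  obtains A where "separated_prime u A" "\<And>y. y \<in> carrier R \<Longrightarrow> root_over A y"
proof -
  let ?F = "{A. separated_prime u A}"
  let ?P = "\<lambda>A B. A \<subseteq> B \<and> A \<inter> multiples u B \<subseteq> multiples u A"
  have uc: "u \<in> carrier R" "u \<noteq> \<zero>"
    using separated_primeD(3)[OF u] subring_mem_carrier[OF separated_primeD(1,2)[OF u]] by auto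
  have "\<exists>m\<in>?F. \<forall>a\<in>?F. ?P m a \<longrightarrow> a = m"
  proof (rule predicate_Zorn)
    show "partial_order_on ?F (relation_of ?P ?F)"
      unfolding partial_order_on_def preorder_on_def
      by (auto simp: relation_of_def refl_on_def trans_def antisym_def)
    fix C assume C: "C \<in> Chains (relation_of ?P ?F)"
    then have sep: "separated_prime u A" if "A \<in> C" for A
      using that unfolding Chains_def relation_of_def by auto
    have cmp: "?P A B \<or> ?P B A" if "A \<in> C" "B \<in> C" for A B
      using C that unfolding Chains_def relation_of_def by auto
    show "\<exists>U\<in>?F. \<forall>A\<in>C. ?P A U"
    proof (cases "C = {}")
      case True
      then show ?thesis using u by (intro bexI[of _ A0]) simp_all
    next
      case False
      let ?U = "\<Union>C"
      have two: "\<exists>D\<in>C. x \<in> D \<and> y \<in> D" if xy: "x \<in> ?U" "y \<in> ?U" for x y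
      proof -
        obtain A B where AB: "A \<in> C" "x \<in> A" "B \<in> C" "y \<in> B" using xy by auto
        then show ?thesis using cmp[OF AB(1,3)] by auto
      qed
      have contr: "x \<in> multiples u A" if "A \<in> C" "x \<in> A" "x \<in> multiples u ?U" for A x
      proof -
        obtain z where z: "z \<in> ?U" "x = u \<otimes> z"
          using \<open>x \<in> multiples u ?U\<close> by (rule multiplesE)
        then obtain D where D: "D \<in> C" "z \<in> D" by auto
        then have "x \<in> multiples u D" using z multiplesI by simp
        then show ?thesis using cmp[OF \<open>A \<in> C\<close> D(1)] that D z multiplesI by auto
      qed
      \<comment> \<open>The order speaks of \<open>u\<close> alone; cancelling one factor
        \<open>u\<close> at a time extends it to all powers, as separation of the union
        requires.\<close>
      have contr_pow: "x \<in> multiples (u [^] k) A"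
        if "A \<in> C" "x \<in> A" "x \<in> multiples (u [^] k) ?U" for A x and k :: nat
        using that
      proof (induction k arbitrary: x)
        case 0
        have "x \<in> carrier R" by (rule subring_mem_carrier[OF separated_primeD(1)[OF sep[OF 0(1)]] 0(2)])
        then have "x = u [^] (0::nat) \<otimes> x" by simp
        then show ?case using multiplesI[OF 0(2)] by metis
      next
        case (Suc k)
        note As = separated_primeD[OF sep[OF Suc.prems(1)]]
        obtain z where z: "z \<in> ?U" "x = u [^] Suc k \<otimes> z" using Suc.prems(3) by (rule multiplesE)
        then obtain D where D: "D \<in> C" "z \<in> D" by auto
        note Ds = separated_primeD[OF sep[OF D(1)]]
        have zc: "z \<in> carrier R" using subring_mem_carrier[OF Ds(1) D(2)] .
        have ukz: "u [^] k \<otimes> z \<in> ?U"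
          using subringE(6)[OF Ds(1) subring_nat_pow[OF Ds(1,2)] D(2)] D(1) by auto
        have x: "x = u \<otimes> (u [^] k \<otimes> z)" unfolding z using uc zc by (simp add: m_ac)
        then have "x \<in> multiples u ?U" using multiplesI[OF ukz] by simp
        then have "x \<in> multiples u A" using contr Suc.prems by simp
        then obtain b where b: "b \<in> A" "x = u \<otimes> b" by (rule multiplesE)
        have bc: "b \<in> carrier R" using subring_mem_carrier[OF As(1) b(1)] .
        have "b = u [^] k \<otimes> z" using x b(2) m_lcancel uc bc zc by auto
        then have "b \<in> multiples (u [^] k) ?U" using multiplesI[OF z(1)] by simp
        then have "b \<in> multiples (u [^] k) A" using Suc.IH Suc.prems(1) b(1) by simp
        then obtain c where c: "c \<in> A" "b = u [^] k \<otimes> c" by (rule multiplesE)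
        then have "x = u [^] Suc k \<otimes> c"
          using b(2) uc subring_mem_carrier[OF As(1) c(1)] by (simp add: m_ac)
        then show ?case using multiplesI[OF c(1)] by metis
      qed
      have U: "subring ?U R"
        by (rule subring_Union[OF False separated_primeD(1)[OF sep]]) (use cmp in auto)
      have "separated_prime u ?U"
        unfolding separated_prime_def
      proof (intro conjI ballI impI U uc(2))
        show "u \<in> ?U" using False separated_primeD(2)[OF sep] by (meson UnionI ex_in_conv)
        show "\<one> \<notin> multiples u ?U"
        proof
          assume *: "\<one> \<in> multiples u ?U"
          obtain A where A: "A \<in> C" using False by auto
          then show False
            using contr[OF A _ *] separated_primeD(4)[OF sep[OF A]]
              subringE(3)[OF separated_primeD(1)[OF sep[OF A]]] by simp
        qed
      next
        fix x y assume xy: "x \<in> ?U" "y \<in> ?U" "x \<otimes> y \<in> multiples u ?U"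
        then obtain D where D: "D \<in> C" "x \<in> D" "y \<in> D" using two by auto
        note Ds = separated_primeD[OF sep[OF D(1)]]
        have "x \<otimes> y \<in> multiples u D" using contr[OF D(1) subringE(6)[OF Ds(1) D(2,3)] xy(3)] .
        then have "x \<in> multiples u D \<or> y \<in> multiples u D" using Ds(5)[OF D(2,3)] by simp
        then show "x \<in> multiples u ?U \<or> y \<in> multiples u ?U"
          using multiples_mono[of D ?U u] D(1) by auto
      next
        fix x assume x: "x \<in> ?U" "\<forall>k::nat. x \<in> multiples (u [^] k) ?U"
        then obtain D where D: "D \<in> C" "x \<in> D" by auto
        then show "x = \<zero>" using contr_pow[OF D] x(2) separated_primeD(6)[OF sep[OF D(1)]] by simp
      qed
      then show ?thesis using contr by (intro bexI[of _ ?U] ballI conjI subsetI) auto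
    qed
  qed
  then obtain A where A: "separated_prime u A"
    and max: "\<And>B. separated_prime u B \<Longrightarrow> ?P A B \<Longrightarrow> B = A" by auto
  note As = separated_primeD[OF A]
  have "root_over A y" if y: "y \<in> carrier R" for y
  proof (rule ccontr)
    assume t: "\<not> root_over A y"
    have "adjoin A y = A"
      using max[OF separated_prime_adjoin[OF As(1) y t A]]
        subset_adjoin[OF As(1) y] adjoin_contraction[OF As(1) y t As(2)] by simp
    then have "y \<in> A" using mem_adjoin[OF As(1) y] by simp
    then have "\<one> \<otimes> y [^] (1::nat) \<in> polys A y 1"
      using polys_const[OF As(1) y, of y 0] y by simp
    then show False using t subringE(3)[OF As(1)] unfolding root_over_def by (metis one_not_zero)
  qed
  then show ?thesis by (rule that[OF A])
qed

section \<open>Chevalley extension of the valuation\<close>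

lemma polys_shift_pow:
  assumes S: "subring S R" and z: "z \<in> carrier R" and f: "f \<in> polys S z n"
  shows "z [^] (d::nat) \<otimes> f \<in> polys S z (d + n)"
proof (induction d)
  case 0
  then show ?case using f polys_carrier[OF S z f] by simp
next
  case (Suc d)
  have "z [^] Suc d \<otimes> f = z \<otimes> (z [^] d \<otimes> f)"
    using z polys_carrier[OF S z f] by (simp add: m_ac)
  then show ?case using polys_shift[OF S z Suc] by simp
qed

text \<open>
  Chevalley's argument: of the two relations the one of larger degree can be shortened by means of the
  other, so neither can exist alongside the other.
\<close>

lemma chevalley:
  assumes S: "subring S R" and A: "subring A R" "A \<subseteq> S" and z: "z \<in> carrier R" "z \<noteq> \<zero>"
    and u: "u \<in> A"
    and prime: "\<And>x y. x \<in> A \<Longrightarrow> y \<in> A \<Longrightarrow> x \<otimes> y \<in> multiples u A \<Longrightarrow>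
       x \<in> multiples u A \<or> y \<in> multiples u A"
    and contr: "A \<inter> multiples u S \<subseteq> multiples u A"
  shows "a \<in> A - multiples u A \<Longrightarrow> b \<in> A - multiples u A \<Longrightarrow>
     f \<in> polys S z (Suc n) \<Longrightarrow> a = u \<otimes> f \<Longrightarrow>
     g \<in> polys S z (Suc m) \<Longrightarrow> b \<otimes> z [^] m = u \<otimes> g \<Longrightarrow> False"
proof (induction "n + m" arbitrary: n m a b f g rule: less_induct)
  case less
  note a = less.prems(1) and b = less.prems(2)
  have cst: "f \<in> S" if "f \<in> polys S z (Suc 0)" for f
    using polys_Suc_split[OF S z(1) that] subring_mem_carrier[OF S] z(1) by auto
  \<comment> \<open>Divided by \<open>z [^] m\<close>, the second relation is one in
    \<open>1/z\<close>. So the two relations write elements of \<open>A\<close> outside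
    \<open>multiples u A\<close> as multiples of \<open>u\<close> over \<open>S[z]\<close> and over
    \<open>S[1/z]\<close>. A relation of degree \<open>0\<close> lives in \<open>S\<close> and
    contradicts \<open>contr\<close>.\<close>
  have no: False if "x \<in> A - multiples u A" "x = u \<otimes> s" "s \<in> S" for x s
    using that contr multiplesI by auto
  have ab: "a \<otimes> b \<in> A - multiples u A"
    using prime a b subringE(6)[OF A(1)] by auto
  have aS: "a \<in> S" "b \<in> S" "u \<in> S" using a b u A(2) by auto
  note cS = subring_mem_carrier[OF S] and cp = polys_carrier[OF S z(1)]
  have c: "a \<in> carrier R" "b \<in> carrier R" "u \<in> carrier R" using aS cS by auto
  note closed = subringE(6)[OF S] subringE(7)[OF S] subring_minus[OF S]
  show False
  proof (cases n)
    case 0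
    then show False using no[OF a less.prems(4)] cst less.prems(3) by simp
  next
    case n: (Suc n')
    show False
    proof (cases m)
      case 0
      then have "b = u \<otimes> g" using less.prems(6) c(2) by simp
      then show False using no[OF b] cst less.prems(5) 0 by metis
    next
      case m: (Suc m')
      show False
      proof (cases "m \<le> n")
        case True
        define d where "d = n - m"
        then have nd: "n = d + m" using True by simp
        obtain f1 s where f: "f1 \<in> polys S z n" "s \<in> S" "f = f1 \<oplus> s \<otimes> z [^] n"
          using polys_SucE[OF S z(1) less.prems(3)] .
        obtain g1 t where g: "g1 \<in> polys S z m" "t \<in> S" "g = g1 \<oplus> t \<otimes> z [^] m"
          using polys_SucE[OF S z(1) less.prems(5)] .
        \<comment> \<open>The leading term of \<open>g\<close> is absorbed on the left, giving
          \<open>(b \<ominus> u \<otimes> t) \<otimes> z [^] m = u \<otimes> g1\<close>. Multiplying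
          \<open>a = u \<otimes> f\<close> by this coefficient turns the top term of
          \<open>f\<close> into a multiple of \<open>z [^] d \<otimes> g1\<close>, of degree below
          \<open>n\<close>; the summand \<open>a \<otimes> t\<close> makes up for the part
          \<open>u \<otimes> t\<close>.\<close>
        define h where "h = (b \<ominus> u \<otimes> t) \<otimes> f1 \<oplus> (s \<otimes> u) \<otimes> (z [^] d \<otimes> g1) \<oplus> a \<otimes> t"
        define W V where "W = z [^] d" and "V = z [^] m"
        have cc: "f1 \<in> carrier R" "g1 \<in> carrier R" "s \<in> carrier R" "t \<in> carrier R"
          "W \<in> carrier R" "V \<in> carrier R"
          using cp[OF f(1)] cp[OF g(1)] cS f(2) g(2) z unfolding W_def V_def by auto
        have zn: "z [^] n = W \<otimes> V" unfolding nd W_def V_def using z by (simp add: nat_pow_mult)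
        have "b \<otimes> V = u \<otimes> g1 \<oplus> (u \<otimes> t) \<otimes> V"
          using less.prems(6) c cc unfolding g(3) V_def[symmetric] by algebra
        moreover have "(b \<ominus> u \<otimes> t) \<otimes> V = b \<otimes> V \<ominus> (u \<otimes> t) \<otimes> V"
          using c cc by algebra
        moreover have "u \<otimes> g1 \<oplus> (u \<otimes> t) \<otimes> V \<ominus> (u \<otimes> t) \<otimes> V = u \<otimes> g1" using c cc by algebra
        ultimately have r: "(b \<ominus> u \<otimes> t) \<otimes> V = u \<otimes> g1" by simp
        have "a \<otimes> b = (b \<ominus> u \<otimes> t) \<otimes> a \<oplus> u \<otimes> (a \<otimes> t)" using c cc by algebra
        also have "\<dots> = u \<otimes> ((b \<ominus> u \<otimes> t) \<otimes> f1 \<oplus> s \<otimes> (W \<otimes> ((b \<ominus> u \<otimes> t) \<otimes> V)) \<oplus> a \<otimes> t)"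
          unfolding less.prems(4) f(3) zn using c cc by algebra
        also have "\<dots> = u \<otimes> h" unfolding r h_def W_def[symmetric] using c cc by algebra
        finally have eq: "a \<otimes> b = u \<otimes> h" .
        have "z [^] d \<otimes> g1 \<in> polys S z n"
          using polys_shift_pow[OF S z(1) g(1), of d] unfolding nd .
        then have "h \<in> polys S z n"
          unfolding h_def
          using polys_add[OF S z(1)] polys_smult[OF S z(1)] f g aS closed polys_const[OF S z(1)] n
          by simp
        then show False
          using less.hyps[of n' m "a \<otimes> b" b h g] n ab b eq less.prems by simp
      next
        case False
        obtain s f1 where f: "s \<in> S" "f1 \<in> polys S z n" "f = s \<oplus> z \<otimes> f1"
          using polys_Suc_split[OF S z(1) less.prems(3)] .
        obtain t g1 where g: "t \<in> S" "g1 \<in> polys S z m" "g = t \<oplus> z \<otimes> g1"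
          using polys_Suc_split[OF S z(1) less.prems(5)] .
        \<comment> \<open>The mirror image, at the constant terms:
          \<open>a \<ominus> u \<otimes> s\<close> is a multiple of \<open>z\<close>, so multiplying
          the second relation by it makes the contribution of \<open>t\<close> divisible by
          \<open>z\<close>, and one factor \<open>z\<close> cancels. The part
          \<open>u \<otimes> s\<close>, moved to the right, becomes the first summand of
          \<open>h\<close>.\<close>
        define h where "h = (s \<otimes> b) \<otimes> z [^] m' \<oplus> (t \<otimes> u) \<otimes> f1 \<oplus> (a \<ominus> u \<otimes> s) \<otimes> g1"
        define W where "W = z [^] m'"
        have cc: "f1 \<in> carrier R" "g1 \<in> carrier R" "s \<in> carrier R" "t \<in> carrier R" "W \<in> carrier R"
          using cp[OF f(2)] cp[OF g(2)] cS f(1) g(1) z unfolding W_def by auto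
        have zm: "z [^] m = z \<otimes> W" unfolding m W_def using z by (simp add: m_comm)
        have r: "a \<ominus> u \<otimes> s = u \<otimes> (z \<otimes> f1)"
          unfolding less.prems(4) f(3) using c cc z(1) by algebra
        have "z \<otimes> ((a \<otimes> b) \<otimes> W) = (a \<ominus> u \<otimes> s) \<otimes> (b \<otimes> z [^] m) \<oplus> u \<otimes> s \<otimes> b \<otimes> z \<otimes> W"
          unfolding zm using c cc z(1) by algebra
        also have "\<dots> = u \<otimes> (t \<otimes> (a \<ominus> u \<otimes> s)) \<oplus> z \<otimes> (u \<otimes> ((a \<ominus> u \<otimes> s) \<otimes> g1)) \<oplus> u \<otimes> s \<otimes> b \<otimes> z \<otimes> W"
          unfolding less.prems(6) g(3) using c cc z(1) by algebra
        also have "u \<otimes> (t \<otimes> (a \<ominus> u \<otimes> s)) = z \<otimes> (u \<otimes> ((t \<otimes> u) \<otimes> f1))"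
          unfolding r using c cc z(1) by algebra
        also have "z \<otimes> (u \<otimes> ((t \<otimes> u) \<otimes> f1)) \<oplus> z \<otimes> (u \<otimes> ((a \<ominus> u \<otimes> s) \<otimes> g1)) \<oplus> u \<otimes> s \<otimes> b \<otimes> z \<otimes> W
          = z \<otimes> (u \<otimes> h)"
          unfolding h_def W_def[symmetric] using c cc z(1) by algebra
        finally have "z \<otimes> ((a \<otimes> b) \<otimes> W) = z \<otimes> (u \<otimes> h)" .
        moreover have "h \<in> carrier R" unfolding h_def W_def[symmetric] using c cc by simp
        ultimately have eq: "(a \<otimes> b) \<otimes> z [^] m' = u \<otimes> h"
          using m_lcancel z c cc unfolding W_def[symmetric] by simp
        have "f1 \<in> polys S z m" using polys_mono[OF S z(1) _ f(2)] False by simp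
        moreover have "(s \<otimes> b) \<otimes> z [^] m' \<in> polys S z m"
          using polys_monom[OF S z(1)] closed f(1) aS m by simp
        ultimately have "h \<in> polys S z m"
          unfolding h_def
          using polys_add[OF S z(1)] polys_smult[OF S z(1)] f g aS closed by simp
        then show False
          using less.hyps[of n m' a "a \<otimes> b" f h] m ab a eq less.prems by simp
      qed
    qed
  qed
qed

text \<open>\<open>S\<close> is maximal among the subrings above \<open>A\<close> in which
  \<open>u\<close> divides no further element of \<open>A\<close>. For nonzero \<open>y\<close>,
  some \<open>z = u^(l+1) y\<close> satisfies a Chevalley relation in \<open>1/z\<close>; adjoining
  \<open>z\<close> to \<open>S\<close> then creates none in \<open>z\<close>, and maximality puts
  \<open>z\<close> into \<open>S\<close>.\<close>

lemma exists_dominating_subring: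
  assumes sep: "separated_prime u A" and alg: "\<And>y. y \<in> carrier R \<Longrightarrow> root_over A y"
  obtains S where "subring S R" "A \<subseteq> S" "A \<inter> multiples u S \<subseteq> multiples u A"
    "\<forall>y\<in>carrier R. \<exists>k::nat. u [^] k \<otimes> y \<in> S"
proof -
  note D = separated_primeD[OF sep]
  have uc: "u \<in> carrier R" by (rule subring_mem_carrier[OF D(1,2)])
  let ?F = "{S. subring S R \<and> A \<subseteq> S \<and> A \<inter> multiples u S \<subseteq> multiples u A}"
  have "\<exists>M\<in>?F. \<forall>W\<in>?F. M \<subseteq> W \<longrightarrow> W = M"
  proof (rule subset_Zorn_nonempty)
    show "?F \<noteq> {}" using D(1) by auto
    fix C assume C: "C \<noteq> {}" "subset.chain ?F C"
    have "subring (\<Union>C) R"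
    proof (rule subring_Union[OF C(1)])
      show "subring A R" if "A \<in> C" for A using that C(2) by (auto simp: subset_chain_def)
      show "A \<subseteq> B \<or> B \<subseteq> A" if "A \<in> C" "B \<in> C" for A B
        using that C(2) by (simp add: subset_chain_def)
    qed
    moreover obtain S where "S \<in> C" "A \<subseteq> S" using C by (auto simp: subset_chain_def)
    then have "A \<subseteq> \<Union>C" by auto
    moreover have "A \<inter> multiples u (\<Union>C) \<subseteq> multiples u A"
    proof
      fix x assume x: "x \<in> A \<inter> multiples u (\<Union>C)"
      then have "x \<in> multiples u (\<Union>C)" by simp
      then obtain w where "w \<in> \<Union>C" "x = u \<otimes> w" by (rule multiplesE)
      then obtain S where "S \<in> C" "x \<in> multiples u S" using multiplesI by auto
      then show "x \<in> multiples u A" using C(2) x by (auto simp: subset_chain_def)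
    qed
    ultimately show "\<Union>C \<in> ?F" by simp
  qed
  then obtain S where "S \<in> ?F" "\<forall>W\<in>?F. S \<subseteq> W \<longrightarrow> W = S" ..
  then have S: "subring S R" and AS: "A \<subseteq> S" and contr: "A \<inter> multiples u S \<subseteq> multiples u A"
    and max: "\<And>W. subring W R \<Longrightarrow> A \<subseteq> W \<Longrightarrow> A \<inter> multiples u W \<subseteq> multiples u A \<Longrightarrow> S \<subseteq> W \<Longrightarrow> W = S"
    by auto
  have "\<exists>k::nat. u [^] k \<otimes> y \<in> S" if y: "y \<in> carrier R" for y
  proof (cases "y = \<zero>")
    case True
    then have "u [^] (0::nat) \<otimes> y \<in> S" using subringE(2)[OF S] by simp
    then show ?thesis ..
  next
    case False
    obtain n b where b: "b \<in> A" "b \<noteq> \<zero>" "b \<otimes> y [^] n \<in> polys A y n"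
      using alg[OF y] unfolding root_over_def by auto
    \<comment> \<open>The minimum exists by separation. Its predecessor \<open>l\<close> is the
      exponent of \<open>u\<close> in \<open>b\<close>, and the cofactor \<open>b'\<close> lies
      outside \<open>multiples u A\<close>.\<close>
    let ?k = "LEAST k::nat. b \<notin> multiples (u [^] k) A"
    have k: "b \<notin> multiples (u [^] ?k) A"
    proof (rule LeastI_ex, rule ccontr)
      assume "\<nexists>k::nat. b \<notin> multiples (u [^] k) A"
      then show False using D(6)[OF b(1)] b(2) by simp
    qed
    have bc: "b \<in> carrier R" by (rule subring_mem_carrier[OF D(1) b(1)])
    have "b = u [^] (0::nat) \<otimes> b" using bc by simp
    then have "b \<in> multiples (u [^] (0::nat)) A" using multiplesI[OF b(1)] by metis
    then obtain l where l: "?k = Suc l" using k by (metis nat.exhaust)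
    then have "b \<in> multiples (u [^] l) A" using not_less_Least[of l "\<lambda>k. b \<notin> multiples (u [^] k) A"] by simp
    then obtain b' where b': "b' \<in> A" "b = u [^] l \<otimes> b'" by (rule multiplesE)
    have b'c: "b' \<in> carrier R" by (rule subring_mem_carrier[OF D(1) b'(1)])
    have b'u: "b' \<notin> multiples u A"
    proof
      assume "b' \<in> multiples u A"
      then obtain c where c: "c \<in> A" "b' = u \<otimes> c" by (rule multiplesE)
      then have "b = u [^] Suc l \<otimes> c"
        using b'(2) uc subring_mem_carrier[OF D(1) c(1)] by (simp add: m_ac)
      then show False using k l multiplesI[OF c(1)] by metis
    qed
    \<comment> \<open>One power more than the exponent of \<open>u\<close> in \<open>b\<close>: once
      \<open>u [^] l\<close> is cancelled from both sides, a factor \<open>u\<close> is still left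
      on the right of \<open>rel\<close>.\<close>
    define v where "v = u [^] Suc l"
    have v: "v \<in> A" "v \<in> carrier R" "v \<noteq> \<zero>"
      using subring_nat_pow[OF D(1,2), of "Suc l"] uc D(3) nat_pow_eq_0_iff[OF uc, of "Suc l"]
      unfolding v_def by (simp_all del: nat_pow_Suc)
    define z where "z = v \<otimes> y"
    have z: "z \<in> carrier R" "z \<noteq> \<zero>" unfolding z_def using v y False integral_iff by auto
    obtain g where g: "g \<in> polys A z n" "v [^] n \<otimes> (b \<otimes> y [^] n) = v \<otimes> g"
      using polys_scale[OF D(1) v(1) y b(3)] unfolding z_def by auto
    have gc: "g \<in> carrier R" by (rule polys_carrier[OF D(1) z(1) g(1)])
    have "u [^] l \<otimes> (b' \<otimes> z [^] n) = v [^] n \<otimes> (b \<otimes> y [^] n)"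
      unfolding z_def b'(2) using v y uc b'c by (simp add: nat_pow_distrib m_ac)
    also have "\<dots> = u [^] l \<otimes> (u \<otimes> g)" unfolding g(2) unfolding v_def using uc gc by (simp add: m_ac)
    finally have rel: "b' \<otimes> z [^] n = u \<otimes> g"
      using m_lcancel[of "u [^] l"] uc gc b'c z D(3) by simp
    have gS: "g \<in> polys S z (Suc n)"
      using polys_Suc_mono[OF S z(1) polys_subset[OF AS g(1)]] .
    have "z \<in> S"
    proof (rule ccontr)
      assume "z \<notin> S"
      let ?B = "adjoin S z"
      have "\<not> A \<inter> multiples u ?B \<subseteq> multiples u A"
        using max[OF subring_adjoin[OF S z(1)]] AS subset_adjoin[OF S z(1)] mem_adjoin[OF S z(1)]
          \<open>z \<notin> S\<close> by auto
      then obtain a where a: "a \<in> A - multiples u A" "a \<in> multiples u ?B" by auto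
      then obtain f where f: "f \<in> ?B" "a = u \<otimes> f" by (metis multiplesE)
      then obtain k where "f \<in> polys S z k" unfolding adjoin_def by auto
      then have "f \<in> polys S z (Suc k)" by (rule polys_Suc_mono[OF S z(1)])
      then show False
        using chevalley[OF S D(1) AS z D(2) D(5) contr a(1) _ _ f(2) gS rel] b' b'u by simp
    qed
    then show ?thesis unfolding z_def v_def by (rule exI)
  qed
  then have "\<forall>y\<in>carrier R. \<exists>k::nat. u [^] k \<otimes> y \<in> S" ..
  then show ?thesis by (rule that[OF S AS contr])
qed

theorem submaximal_if_separated_prime_unit:
  assumes u: "u \<in> Units R" and sep: "separated_prime u A0"
  shows "submaximal R"
proof -
  obtain A where A: "separated_prime u A" "\<And>y. y \<in> carrier R \<Longrightarrow> root_over A y"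
    by (rule exists_algebraic_separated_prime[OF sep]) metis
  obtain S where S: "subring S R" "A \<subseteq> S" "A \<inter> multiples u S \<subseteq> multiples u A"
    "\<forall>y\<in>carrier R. \<exists>k::nat. u [^] k \<otimes> y \<in> S"
    by (rule exists_dominating_subring[OF A])
  note D = separated_primeD[OF A(1)]
  have uc: "u \<in> carrier R" "inv u \<in> carrier R" "u \<otimes> inv u = \<one>" "inv u \<otimes> u = \<one>"
    using Units_closed[OF u] Units_inv_closed[OF u] Units_r_inv[OF u] Units_l_inv[OF u] by simp_all
  show ?thesis
  proof (rule submaximal_if_generated[OF S(1) uc(2)])
    show "inv u \<notin> S"
    proof
      assume "inv u \<in> S"
      then have "\<one> \<in> multiples u S" using multiplesI[of "inv u" S u] uc by simp
      then show False using S(3) D(4) subringE(3)[OF D(1)] by auto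
    qed
    fix T assume T: "subring T R" "S \<subseteq> T" "inv u \<in> T"
    have "y \<in> T" if y: "y \<in> carrier R" for y
    proof -
      obtain k :: nat where k: "u [^] k \<otimes> y \<in> S" using S(4) y by auto
      have "(inv u) [^] k \<otimes> u [^] k = \<one>"
        using nat_pow_distrib[OF uc(2,1), of k] uc by simp
      then have "y = (inv u) [^] k \<otimes> (u [^] k \<otimes> y)"
        using uc y by (simp add: m_assoc[symmetric])
      moreover have "(inv u) [^] k \<otimes> (u [^] k \<otimes> y) \<in> T"
        using subringE(6)[OF T(1) subring_nat_pow[OF T(1,3)]] k T(2) by auto
      ultimately show ?thesis by simp
    qed
    then show "T = carrier R" using subringE(1)[OF T(1)] by auto
  qed
qed

end

section \<open>Units of domains without maximal subrings\<close>

context cring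
begin

lemma UnitsI: "x \<in> carrier R \<Longrightarrow> y \<in> carrier R \<Longrightarrow> x \<otimes> y = \<one> \<Longrightarrow> x \<in> Units R"
  unfolding Units_def using m_comm[of x y] by auto

definition prime_subring :: "'a set" where
  "prime_subring = range (of_integer R)"

lemma subring_prime_subring: "subring prime_subring R"
proof (rule subringI)
  show "prime_subring \<subseteq> carrier R" unfolding prime_subring_def by auto
  show "\<one> \<in> prime_subring" unfolding prime_subring_def by (rule range_eqI[of _ _ 1]) simp
  show "\<ominus> h \<in> prime_subring" if h: "h \<in> prime_subring" for h
  proof -
    obtain i where "h = \<guillemotleft>i\<guillemotright>" using h unfolding prime_subring_def by auto
    then have "\<ominus> h = \<guillemotleft>- i\<guillemotright>" by simp
    then show ?thesis unfolding prime_subring_def by (rule range_eqI)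
  qed
  fix h k assume "h \<in> prime_subring" "k \<in> prime_subring"
  then obtain i j where "h = \<guillemotleft>i\<guillemotright>" "k = \<guillemotleft>j\<guillemotright>" unfolding prime_subring_def by auto
  then have "h \<otimes> k = \<guillemotleft>i * j\<guillemotright>" "h \<oplus> k = \<guillemotleft>i + j\<guillemotright>" by simp_all
  then show "h \<otimes> k \<in> prime_subring" "h \<oplus> k \<in> prime_subring"
    unfolding prime_subring_def by (metis rangeI)+
qed

lemma finite_prime_subring:
  assumes k: "\<guillemotleft>k\<guillemotright> = \<zero>" "k \<noteq> 0"
  shows "finite prime_subring"
proof -
  have "\<guillemotleft>i\<guillemotright> = \<guillemotleft>i mod \<bar>k\<bar>\<guillemotright>" for i
  proof -
    have "\<guillemotleft>\<bar>k\<bar>\<guillemotright> = \<zero>" using k(1) by (simp add: abs_if)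
    have "\<guillemotleft>i\<guillemotright> = \<guillemotleft>\<bar>k\<bar> * (i div \<bar>k\<bar>) + i mod \<bar>k\<bar>\<guillemotright>" by (simp only: mult_div_mod_eq)
    also have "\<dots> = \<guillemotleft>i mod \<bar>k\<bar>\<guillemotright>"
      unfolding of_int_add of_int_mult \<open>\<guillemotleft>\<bar>k\<bar>\<guillemotright> = \<zero>\<close> by simp
    finally show ?thesis .
  qed
  moreover have "i mod \<bar>k\<bar> \<in> {0..<\<bar>k\<bar>}" for i using k(2) by simp
  ultimately have "prime_subring \<subseteq> of_integer R ` {0..<\<bar>k\<bar>}"
    unfolding prime_subring_def by (metis (no_types, lifting) image_eqI image_subsetI)
  then show ?thesis using finite_subset by auto
qed

lemma finite_polys: "finite A \<Longrightarrow> finite (polys A z n)"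
proof (induction n)
  case (Suc n)
  have "polys A z (Suc n) = (\<lambda>(a, f). a \<oplus> z \<otimes> f) ` (A \<times> polys A z n)"
    by (auto simp: polys.simps(2))
  then show ?case using Suc by simp
qed simp

lemma polys_translate:
  assumes A: "subring A R" and s: "s \<in> carrier R"
  shows "f \<in> polys A (\<one> \<oplus> s) n \<Longrightarrow> f \<in> polys A s n"
proof (induction n arbitrary: f)
  case (Suc n)
  have s1: "\<one> \<oplus> s \<in> carrier R" using s by simp
  obtain a g where f: "a \<in> A" "g \<in> polys A (\<one> \<oplus> s) n" "f = a \<oplus> (\<one> \<oplus> s) \<otimes> g"
    using polys_Suc_split[OF A s1 Suc.prems] .
  have g: "g \<in> polys A s n" by (rule Suc.IH[OF f(2)])
  have "f = (a \<oplus> s \<otimes> g) \<oplus> g"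
    using f(3) s polys_carrier[OF A s g] subring_mem_carrier[OF A f(1)] by algebra
  then show ?case
    using polys_add[OF A s polys_SucI[OF A s f(1) g] polys_Suc_mono[OF A s g]] by simp
qed simp

lemma power_translate:
  assumes A: "subring A R" and s: "s \<in> carrier R"
  shows "\<exists>g \<in> polys A s n. (\<one> \<oplus> s) [^] n = s [^] n \<oplus> g"
proof (induction n)
  case 0
  then show ?case by simp
next
  case (Suc n)
  then obtain g where g: "g \<in> polys A s n" "(\<one> \<oplus> s) [^] n = s [^] n \<oplus> g" ..
  have c: "g \<in> carrier R" "s [^] n \<in> carrier R" using polys_carrier[OF A s g(1)] s by simp_all
  have "(\<one> \<oplus> s) [^] Suc n = s [^] Suc n \<oplus> (\<one> \<otimes> s [^] n \<oplus> g \<oplus> s \<otimes> g)"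
    unfolding nat_pow_Suc g(2) using c s by algebra
  moreover have "\<one> \<otimes> s [^] n \<in> polys A s (Suc n)"
    by (rule polys_monom[OF A s subringE(3)[OF A]]) simp
  then have "\<one> \<otimes> s [^] n \<oplus> g \<oplus> s \<otimes> g \<in> polys A s (Suc n)"
    using polys_add[OF A s] polys_Suc_mono[OF A s g(1)] polys_shift[OF A s g(1)] by simp
  ultimately show ?case by (rule bexI)
qed

text \<open>Translation keeps the leading coefficient and changes only lower terms. It leads from a
  unit \<open>\<one> \<oplus> s\<close>, known to be algebraic, to the nonunit
  \<open>s\<close>.\<close>

lemma root_over_translate:
  assumes A: "subring A R" and s: "s \<in> carrier R" and r: "root_over A (\<one> \<oplus> s)"
  shows "root_over A s"
proof -
  obtain n b where b: "b \<in> A" "b \<noteq> \<zero>" "b \<otimes> (\<one> \<oplus> s) [^] n \<in> polys A (\<one> \<oplus> s) n"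
    using r unfolding root_over_def by auto
  obtain g where g: "g \<in> polys A s n" "(\<one> \<oplus> s) [^] n = s [^] n \<oplus> g"
    using power_translate[OF A s] by auto
  have c: "b \<in> carrier R" "g \<in> carrier R" "s [^] n \<in> carrier R"
    using subring_mem_carrier[OF A b(1)] polys_carrier[OF A s g(1)] s by simp_all
  have "b \<otimes> s [^] n = b \<otimes> (\<one> \<oplus> s) [^] n \<ominus> b \<otimes> g" unfolding g(2) using c by algebra
  then have "b \<otimes> s [^] n \<in> polys A s n"
    using polys_minus[OF A s polys_translate[OF A s b(3)] polys_smult[OF A s b(1) g(1)]] by simp
  then show ?thesis using b unfolding root_over_def by auto
qed

end

context "domain"
begin

text \<open>Divide the relation by \<open>s\<close> until its constant term is nonzero;
  \<open>s\<close> divides all other terms and hence this constant.\<close>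

lemma root_over_dvd_const:
  assumes A: "subring A R" and s: "s \<in> carrier R" "s \<noteq> \<zero>" and r: "root_over A s"
  obtains c w where "c \<in> A" "c \<noteq> \<zero>" "w \<in> carrier R" "c = s \<otimes> w"
proof -
  have "\<exists>c\<in>A. c \<noteq> \<zero> \<and> (\<exists>w\<in>carrier R. c = s \<otimes> w)"
    if "b \<in> A" "b \<noteq> \<zero>" "b \<otimes> s [^] n \<in> polys A s n" for b n
    using that
  proof (induction n)
    case 0
    then show ?case using subring_mem_carrier[OF A 0(1)] by simp
  next
    case (Suc n)
    obtain a f where f: "a \<in> A" "f \<in> polys A s n" "b \<otimes> s [^] Suc n = a \<oplus> s \<otimes> f"
      using polys_Suc_split[OF A s(1) Suc.prems(3)] .
    have c: "a \<in> carrier R" "b \<in> carrier R" "f \<in> carrier R" "s [^] n \<in> carrier R"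
      using subring_mem_carrier[OF A] f(1) Suc.prems(1) polys_carrier[OF A s(1) f(2)] s(1) by auto
    have eq: "s \<otimes> (b \<otimes> s [^] n) = a \<oplus> s \<otimes> f" using f(3) c s(1) by (simp add: m_ac)
    show ?case
    proof (cases "a = \<zero>")
      case True
      then have "b \<otimes> s [^] n = f" using eq m_lcancel[OF s(2,1)] c s(1) by simp
      then show ?thesis using Suc f(2) by simp
    next
      case False
      have "s \<otimes> (b \<otimes> s [^] n \<ominus> f) = s \<otimes> (b \<otimes> s [^] n) \<ominus> s \<otimes> f" using c s(1) by algebra
      also have "\<dots> = a" unfolding eq using c s(1) by algebra
      finally have "a = s \<otimes> (b \<otimes> s [^] n \<ominus> f)" by simp
      moreover have "b \<otimes> s [^] n \<ominus> f \<in> carrier R" using c by simp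
      ultimately show ?thesis using f(1) False by auto
    qed
  qed
  then show ?thesis using r that unfolding root_over_def by metis
qed

text \<open>The valuation is the order of vanishing at \<open>y = 0\<close>. Divisibility by
  \<open>y\<close> means that the constant term is zero, which gives primality in a domain, and the
  degree bounds how often \<open>y\<close> can be split off.\<close>

lemma separated_prime_adjoin_self:
  assumes A: "subring A R" and y: "y \<in> carrier R" and t: "\<not> root_over A y"
  shows "separated_prime y (adjoin A y)"
proof -
  let ?B = "adjoin A y"
  note B = subring_adjoin[OF A y]
  note cA = subring_mem_carrier[OF A] and cB = subring_mem_carrier[OF B]
  have A0: "\<zero> \<in> A" by (rule subringE(2)[OF A])
  have mult_iff: "a \<oplus> y \<otimes> g \<in> multiples y ?B \<longleftrightarrow> a = \<zero>" if ag: "a \<in> A" "g \<in> ?B" for a g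
  proof
    assume "a \<oplus> y \<otimes> g \<in> multiples y ?B"
    then obtain h where h: "h \<in> ?B" "a \<oplus> y \<otimes> g = y \<otimes> h" by (rule multiplesE)
    then have "a \<oplus> y \<otimes> g = \<zero> \<oplus> y \<otimes> h" using cB[OF h(1)] y by simp
    then show "a = \<zero>" using transcendental_unique[OF A y t ag(1) A0 ag(2) h(1)] by simp
  next
    assume "a = \<zero>"
    then show "a \<oplus> y \<otimes> g \<in> multiples y ?B" using multiplesI[OF ag(2)] cB[OF ag(2)] y by simp
  qed
  have y0: "y \<noteq> \<zero>" by (rule transcendental_nonzero[OF A y t])
  have sep: "f = \<zero>" if "f \<in> polys A y n" "\<And>k::nat. f \<in> multiples (y [^] k) ?B" for f n
    using that
  proof (induction n arbitrary: f)
    case (Suc n)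
    obtain a g where f: "a \<in> A" "g \<in> polys A y n" "f = a \<oplus> y \<otimes> g"
      using polys_Suc_split[OF A y Suc.prems(1)] .
    have gB: "g \<in> ?B" by (rule polys_subset_adjoin[OF A y f(2)])
    have "f \<in> multiples y ?B" using Suc.prems(2)[of 1] y by simp
    then have fg: "f = y \<otimes> g" using mult_iff[OF f(1) gB] f(3) cB[OF gB] y by simp
    have "g \<in> multiples (y [^] k) ?B" for k :: nat
    proof -
      obtain h where h: "h \<in> ?B" "f = y [^] Suc k \<otimes> h" using Suc.prems(2) by (rule multiplesE)
      have "y \<otimes> g = y \<otimes> (y [^] k \<otimes> h)" using fg h(2) cB[OF h(1)] y by (simp add: m_ac)
      then have "g = y [^] k \<otimes> h" using m_lcancel[OF y0 y] cB[OF h(1)] cB[OF gB] y by simp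
      then show ?thesis using multiplesI[OF h(1)] by simp
    qed
    then have "g = \<zero>" by (rule Suc.IH[OF f(2)])
    then show ?case using fg y by simp
  qed simp
  show ?thesis
    unfolding separated_prime_def
  proof (intro conjI ballI impI B y0)
    show "y \<in> ?B" by (rule mem_adjoin[OF A y])
    show "\<one> \<notin> multiples y ?B"
      using mult_iff[OF subringE(3)[OF A] subringE(2)[OF B]] y by simp
  next
    fix f g assume fg: "f \<in> ?B" "g \<in> ?B" and m: "f \<otimes> g \<in> multiples y ?B"
    obtain a f' where f: "a \<in> A" "f' \<in> ?B" "f = a \<oplus> y \<otimes> f'" using adjoinE[OF A y fg(1)] .
    obtain b g' where g: "b \<in> A" "g' \<in> ?B" "g = b \<oplus> y \<otimes> g'" using adjoinE[OF A y fg(2)] .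
    have c: "a \<in> carrier R" "b \<in> carrier R" "f' \<in> carrier R" "g' \<in> carrier R"
      using cA[OF f(1)] cA[OF g(1)] cB[OF f(2)] cB[OF g(2)] by simp_all
    have eq: "f \<otimes> g = a \<otimes> b \<oplus> y \<otimes> (a \<otimes> g' \<oplus> f' \<otimes> g)"
      unfolding f(3) g(3) using c y by algebra
    have "a \<in> ?B" using subset_adjoin[OF A y] f(1) by auto
    then have "a \<otimes> g' \<oplus> f' \<otimes> g \<in> ?B" using subringE(6,7)[OF B] f g fg by simp
    then have "a \<otimes> b = \<zero>" using mult_iff[OF subringE(6)[OF A f(1) g(1)]] m eq by simp
    then have "a = \<zero> \<or> b = \<zero>" using integral c by simp
    then show "f \<in> multiples y ?B \<or> g \<in> multiples y ?B"
      using mult_iff[OF f(1,2)] mult_iff[OF g(1,2)] f(3) g(3) by auto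
  next
    fix f assume "f \<in> ?B" and f: "\<forall>k::nat. f \<in> multiples (y [^] k) ?B"
    then obtain n where "f \<in> polys A y n" unfolding adjoin_def by auto
    then show "f = \<zero>" using sep f by metis
  qed
qed

text \<open>Were \<open>u\<close> transcendental over \<open>A\<close>, it would be a separated
  prime in \<open>adjoin A u\<close> and a unit in \<open>R\<close>.\<close>

lemma unit_root_over:
  assumes "\<not> submaximal R" and "subring A R" and u: "u \<in> Units R"
  shows "root_over A u"
  using submaximal_if_separated_prime_unit[OF u]
    separated_prime_adjoin_self[OF assms(2) Units_closed[OF u]] assms(1) by metis

text \<open>Injectivity makes \<open>prime_subring\<close> a copy of the integers, and the valuation
  is the p-adic one.\<close>

lemma separated_prime_of_integer:
  assumes inj: "\<And>k. \<guillemotleft>k\<guillemotright> = \<zero> \<Longrightarrow> k = 0" and p: "Factorial_Ring.prime (p :: int)"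
  shows "separated_prime \<guillemotleft>p\<guillemotright> prime_subring"
proof -
  have inj_iff: "i = j" if "\<guillemotleft>i\<guillemotright> = \<guillemotleft>j\<guillemotright>" for i j
    using inj[of "i - j"] that by (simp add: minus_eq r_neg)
  have mult_iff: "\<guillemotleft>i\<guillemotright> \<in> multiples \<guillemotleft>q\<guillemotright> prime_subring \<longleftrightarrow> q dvd i" for i q
  proof
    assume "\<guillemotleft>i\<guillemotright> \<in> multiples \<guillemotleft>q\<guillemotright> prime_subring"
    then obtain j where "\<guillemotleft>i\<guillemotright> = \<guillemotleft>q\<guillemotright> \<otimes> \<guillemotleft>j\<guillemotright>" unfolding multiples_def prime_subring_def by auto
    then have "i = q * j" by (intro inj_iff) simp
    then show "q dvd i" by simp
  next
    assume "q dvd i"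
    then obtain j where "i = q * j" by (rule dvdE)
    then show "\<guillemotleft>i\<guillemotright> \<in> multiples \<guillemotleft>q\<guillemotright> prime_subring"
      using multiplesI[of "\<guillemotleft>j\<guillemotright>" prime_subring "\<guillemotleft>q\<guillemotright>"] unfolding prime_subring_def by simp
  qed
  show ?thesis
    unfolding separated_prime_def
  proof (intro conjI ballI impI subring_prime_subring)
    show "\<guillemotleft>p\<guillemotright> \<in> prime_subring" unfolding prime_subring_def by simp
    show "\<guillemotleft>p\<guillemotright> \<noteq> \<zero>" using inj[of p] p by auto
    show "\<one> \<notin> multiples \<guillemotleft>p\<guillemotright> prime_subring" using mult_iff[of 1 p] p by (auto simp: not_prime_unit)
  next
    fix x y assume "x \<in> prime_subring" "y \<in> prime_subring"
      and m: "x \<otimes> y \<in> multiples \<guillemotleft>p\<guillemotright> prime_subring"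
    then obtain i j where ij: "x = \<guillemotleft>i\<guillemotright>" "y = \<guillemotleft>j\<guillemotright>" unfolding prime_subring_def by auto
    then have "p dvd i * j" using mult_iff[of "i * j" p] m by simp
    then show "x \<in> multiples \<guillemotleft>p\<guillemotright> prime_subring \<or> y \<in> multiples \<guillemotleft>p\<guillemotright> prime_subring"
      unfolding ij mult_iff using p by (simp add: prime_dvd_mult_iff)
  next
    fix x assume "x \<in> prime_subring"
      and m: "\<forall>k::nat. x \<in> multiples (\<guillemotleft>p\<guillemotright> [^] k) prime_subring"
    then obtain i where i: "x = \<guillemotleft>i\<guillemotright>" unfolding prime_subring_def by auto
    have dvd: "p ^ k dvd i" for k using m[rule_format, of k] mult_iff[of i "p ^ k"] i by simp
    have "i = 0"
    proof (rule ccontr)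
      assume "i \<noteq> 0"
      \<comment> \<open>The absolute value of \<open>i\<close> serves as an exponent that is too
        large, since \<open>2^k\<close> exceeds \<open>k\<close>.\<close>
      then have "p ^ nat \<bar>i\<bar> \<le> \<bar>i\<bar>" using dvd_imp_le_int[OF _ dvd] prime_gt_0_int[OF p] by auto
      moreover have "(2::int) ^ nat \<bar>i\<bar> \<le> p ^ nat \<bar>i\<bar>" using prime_ge_2_int[OF p] by (intro power_mono) auto
      moreover have "int (nat \<bar>i\<bar>) < 2 ^ nat \<bar>i\<bar>" by (rule of_nat_less_two_power)
      ultimately show False by simp
    qed
    then show "x = \<zero>" using i by simp
  qed
qed

lemma prime_not_unit:
  assumes "\<not> submaximal R" and "\<And>k. \<guillemotleft>k\<guillemotright> = \<zero> \<Longrightarrow> k = 0" and "Factorial_Ring.prime (p :: int)"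
  shows "\<guillemotleft>p\<guillemotright> \<notin> Units R"
  using submaximal_if_separated_prime_unit separated_prime_of_integer[OF assms(2,3)] assms(1)
  by metis

section \<open>Roots of unity and countability of fields\<close>

lemma finite_powers_imp_torsion:
  assumes y: "y \<in> carrier R" "y \<noteq> \<zero>" and X: "finite F" "\<And>i::nat. y [^] i \<in> F"
  shows "\<exists>N>0. y [^] (N::nat) = \<one>"
proof -
  have "\<not> inj (\<lambda>i::nat. y [^] i)"
    using X finite_subset[of "range (\<lambda>i::nat. y [^] i)" F] range_inj_infinite by auto
  then obtain i j :: nat where "i \<noteq> j" "y [^] i = y [^] j" unfolding inj_def by auto
  then obtain i j :: nat where ij: "i < j" "y [^] i = y [^] j"
    by (metis nat_neq_iff)
  have "y [^] i \<otimes> y [^] (j - i) = y [^] i \<otimes> \<one>"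
    using ij y nat_pow_mult[of y i "j - i"] by simp
  then have "y [^] (j - i) = \<one>" using m_lcancel[of "y [^] i" "y [^] (j - i)" \<one>] y by simp
  then show ?thesis using ij by (intro exI[of _ "j - i"]) simp
qed

text \<open>As \<open>A\<close> is finite, \<open>b\<close> has an inverse among its own powers, so
  \<open>y\<close> is integral over \<open>A\<close>. All powers of \<open>y\<close> then lie in the
  finite set \<open>polys A y n\<close>.\<close>

lemma root_over_finite_imp_torsion:
  assumes A: "subring A R" "finite A" and y: "y \<in> carrier R" "y \<noteq> \<zero>" and r: "root_over A y"
  shows "\<exists>N>0. y [^] (N::nat) = \<one>"
proof -
  obtain n b where b: "b \<in> A" "b \<noteq> \<zero>" "b \<otimes> y [^] n \<in> polys A y n"
    using r unfolding root_over_def by auto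
  have bc: "b \<in> carrier R" by (rule subring_mem_carrier[OF A(1) b(1)])
  obtain N :: nat where N: "N > 0" "b [^] N = \<one>"
    using finite_powers_imp_torsion[OF bc b(2) A(2)] subring_nat_pow[OF A(1) b(1)] by auto
  have "b [^] (N - 1) \<otimes> b = \<one>" using N by (metis Suc_diff_1 nat_pow_Suc)
  then have "y [^] n = b [^] (N - 1) \<otimes> (b \<otimes> y [^] n)"
    using bc y by (simp add: m_assoc[symmetric])
  then have yn: "y [^] n \<in> polys A y n"
    using polys_smult[OF A(1) y(1) subring_nat_pow[OF A(1) b(1)] b(3), of "N - 1"] by simp
  have one: "\<one> \<in> polys A y n"
  proof (cases n)
    case 0
    then show ?thesis using yn by simp
  next
    case (Suc n')
    then show ?thesis using polys_const[OF A(1) y(1) subringE(3)[OF A(1)]] by simp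
  qed
  have step: "y \<otimes> f \<in> polys A y n" if f: "f \<in> polys A y n" for f
  proof -
    obtain g c where "g \<in> polys A y n" "c \<in> A" "y \<otimes> f = g \<oplus> c \<otimes> y [^] n"
      using polys_SucE[OF A(1) y(1) polys_shift[OF A(1) y(1) f]] .
    then show ?thesis using polys_add[OF A(1) y(1)] polys_smult[OF A(1) y(1) _ yn] by simp
  qed
  have "y [^] i \<in> polys A y n" for i :: nat
  proof (induction i)
    case 0
    then show ?case using one by simp
  next
    case (Suc i)
    then show ?case using step[OF Suc] y by (simp add: m_comm)
  qed
  then show ?thesis by (rule finite_powers_imp_torsion[OF y finite_polys[OF A(2)]])
qed

lemma finite_roots_of_unity:
  assumes "N > 0"
  shows "finite {y \<in> carrier R. y [^] (N::nat) = \<one>}"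
proof -
  obtain n where n: "N = Suc n" using assms by (metis Suc_pred)
  \<comment> \<open>Coefficient lists start with the leading coefficient, so appending an entry
    multiplies by \<open>X\<close> and adds a constant: this is \<open>X^N - 1\<close> with
    \<open>N = Suc n\<close>.\<close>
  let ?p = "monom \<one> n @ [\<ominus> \<one>]"
  have set: "set (monom \<one> n) \<subseteq> carrier R" unfolding monom_def by auto
  have p: "?p \<in> carrier (poly_ring R)"
    unfolding univ_poly_carrier[symmetric] polynomial_def monom_def by auto
  have "is_root ?p y" if y: "y \<in> carrier R" "y [^] N = \<one>" for y
    using y n eval_append_aux[OF set, of "\<ominus> \<one>" y] eval_monom[of \<one> y n]
    unfolding is_root_def by (simp add: r_neg)
  then have "{y \<in> carrier R. y [^] N = \<one>} \<subseteq> {y. is_root ?p y}" by auto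
  then show ?thesis by (rule finite_subset[OF _ finite_number_of_roots[OF p]])
qed

end

text \<open>In characteristic \<open>0\<close> the prime number \<open>2\<close> would be a unit.
  Hence the prime ring is finite and every nonzero element, being a unit and so algebraic over it,
  is a root of unity; each exponent admits finitely many.\<close>

lemma (in field) countable_if_not_submaximal:
  assumes ns: "\<not> submaximal R"
  shows "countable (carrier R)"
proof -
  have unit: "y \<in> Units R" if "y \<in> carrier R" "y \<noteq> \<zero>" for y
    using that field_Units by auto
  have "\<exists>k. \<guillemotleft>k\<guillemotright> = \<zero> \<and> k \<noteq> 0"
  proof (rule ccontr)
    assume "\<not> ?thesis"
    then have inj: "k = 0" if "\<guillemotleft>k\<guillemotright> = \<zero>" for k using that by metis
    have "\<guillemotleft>2\<guillemotright> \<in> Units R" using unit[OF of_int_closed] inj[of 2] by fastforce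
    then show False using prime_not_unit[OF ns inj, of 2] by simp
  qed
  then have fin: "finite prime_subring" using finite_prime_subring by metis
  have "\<exists>N>0. y [^] (N::nat) = \<one>" if "y \<in> carrier R" "y \<noteq> \<zero>" for y
    using root_over_finite_imp_torsion[OF subring_prime_subring fin that
        unit_root_over[OF ns subring_prime_subring unit[OF that]]] .
  then have "carrier R \<subseteq> insert \<zero> (\<Union>N\<in>{0<..}. {y \<in> carrier R. y [^] (N::nat) = \<one>})" by auto
  moreover have "countable (\<Union>N\<in>{0<..}. {y \<in> carrier R. y [^] (N::nat) = \<one>})"
    by (rule countable_UN) (auto intro: countable_finite finite_roots_of_unity)
  ultimately show ?thesis by (rule countable_subset[OF _ countable_insert])
qed

section \<open>G-domains\<close>

context "domain"
begin

lemma common_denominator: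
  assumes "finite A" and "A \<subseteq> carrier (quotient_field R)"
  shows "\<exists>s\<in>nz. \<forall>x\<in>A. \<exists>a\<in>carrier R. x = fraction R a s"
  using assms
proof (induction A)
  case empty
  then show ?case by (intro bexI[of _ \<one>]) auto
next
  case (insert x A)
  then obtain s where s: "s \<in> nz" "\<forall>x\<in>A. \<exists>a\<in>carrier R. x = fraction R a s" by auto
  obtain a t where x: "x = fraction R a t" "a \<in> carrier R" "t \<in> nz"
    using insert.prems by (auto simp: quotient_field_carrier)
  have st: "s \<otimes> t \<in> nz" by (rule nz_mult[OF s(1) x(3)])
  have scale: "fraction R b v = fraction R (b \<otimes> w) (v \<otimes> w)"
    if "b \<in> carrier R" "v \<in> nz" "w \<in> nz" for b v w
    using that nz_mult[OF that(2,3)] by (subst frac_eq_iff) (auto simp: m_ac)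
  have "\<exists>c\<in>carrier R. y = fraction R c (s \<otimes> t)" if y: "y \<in> insert x A" for y
  proof (cases "y = x")
    case True
    have "t \<otimes> s = s \<otimes> t" using s(1) x(3) m_comm by simp
    then have "y = fraction R (a \<otimes> s) (s \<otimes> t)" using scale[OF x(2,3) s(1)] True x(1) by simp
    moreover have "a \<otimes> s \<in> carrier R" using x(2) s(1) by simp
    ultimately show ?thesis by (rule bexI)
  next
    case False
    then obtain b where b: "b \<in> carrier R" "y = fraction R b s" using s(2) y by auto
    then have "y = fraction R (b \<otimes> t) (s \<otimes> t)" using scale[OF b(1) s(1) x(3)] by simp
    moreover have "b \<otimes> t \<in> carrier R" using b x(3) by simp
    ultimately show ?thesis by (rule bexI)
  qed
  then show ?case using st by (intro bexI[of _ "s \<otimes> t"]) simp_all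
qed

lemma power_in_nz: "s \<in> nz \<Longrightarrow> s [^] (k::nat) \<in> nz"
  by auto

text \<open>Finitely many generators have a common denominator \<open>s\<close>, so the quotient
  field is \<open>R[1/s]\<close>, and \<open>1/d\<close> lies in it just when \<open>d\<close>
  divides a power of \<open>s\<close>. The criterion removes fractions from the rest of the
  argument.\<close>

lemma G_domain_iff:
  "G_domain R \<longleftrightarrow> (\<exists>s\<in>nz. \<forall>d\<in>nz. \<exists>c\<in>carrier R. \<exists>k::nat. d \<otimes> c = s [^] k)"
proof
  let ?K = "quotient_field R"
  interpret K: field ?K by (rule field_quotient_field)
  {
    assume "G_domain R"
    then obtain A where A: "finite A" "A \<subseteq> carrier ?K"
      and gen: "generate_ring ?K (quotient_field_embed R ` carrier R \<union> A) = carrier ?K"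
      unfolding G_domain_def by auto
    obtain s where s: "s \<in> nz" "\<forall>x\<in>A. \<exists>a\<in>carrier R. x = fraction R a s"
      using common_denominator[OF A] by auto
    have "\<exists>a\<in>carrier R. \<exists>k::nat. x = fraction R a (s [^] k)"
      if "x \<in> generate_ring ?K (quotient_field_embed R ` carrier R \<union> A)" for x
      using that
    proof induction
      case one
      have "\<one>\<^bsub>?K\<^esub> = fraction R \<one> (s [^] (0::nat))" by (simp add: quotient_field_one)
      then show ?case by (rule bexI[OF exI one_closed])
    next
      case (incl h)
      then consider a where "a \<in> carrier R" "h = fraction R a \<one>" | "h \<in> A"
        unfolding quotient_field_embed_def by auto
      then show ?case
      proof cases
        case 1
        then have "h = fraction R a (s [^] (0::nat))" by simp
        then show ?thesis by (rule bexI[OF exI 1(1)])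
      next
        case 2
        then obtain a where a: "a \<in> carrier R" "h = fraction R a s" using s(2) by auto
        then have "h = fraction R a (s [^] (1::nat))" using s(1) by simp
        then show ?thesis by (rule bexI[OF exI a(1)])
      qed
    next
      case (a_inv h)
      then obtain a and k :: nat where a: "a \<in> carrier R" "h = fraction R a (s [^] k)" by auto
      note sk = power_in_nz[OF s(1), of k]
      have "fraction R (\<ominus> a) (s [^] k) \<oplus>\<^bsub>?K\<^esub> fraction R a (s [^] k) = \<zero>\<^bsub>?K\<^esub>"
        using a sk nz_mult[OF sk sk]
        by (simp add: quotient_field_add quotient_field_zero frac_eq_iff l_minus l_neg)
      then have "\<ominus>\<^bsub>?K\<^esub> h = fraction R (\<ominus> a) (s [^] k)"
        using K.minus_equality[of "fraction R (\<ominus> a) (s [^] k)" h] a sk by simp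
      then show ?case using a(1) by auto
    next
      case (eng_add x y)
      then obtain a b and k l :: nat where ab: "a \<in> carrier R" "x = fraction R a (s [^] k)"
        "b \<in> carrier R" "y = fraction R b (s [^] l)" by auto
      have "x \<oplus>\<^bsub>?K\<^esub> y = fraction R (a \<otimes> s [^] l \<oplus> b \<otimes> s [^] k) (s [^] (k + l))"
        using ab s(1) quotient_field_add[OF ab(1) power_in_nz[OF s(1)] ab(3) power_in_nz[OF s(1)]]
        by (simp add: nat_pow_mult)
      moreover have "a \<otimes> s [^] l \<oplus> b \<otimes> s [^] k \<in> carrier R" using ab s(1) by simp
      ultimately show ?case by auto
    next
      case (eng_mult x y)
      then obtain a b and k l :: nat where ab: "a \<in> carrier R" "x = fraction R a (s [^] k)"
        "b \<in> carrier R" "y = fraction R b (s [^] l)" by auto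
      have "x \<otimes>\<^bsub>?K\<^esub> y = fraction R (a \<otimes> b) (s [^] (k + l))"
        using ab s(1) quotient_field_mult[OF ab(1) power_in_nz[OF s(1)] ab(3) power_in_nz[OF s(1)]]
        by (simp add: nat_pow_mult)
      moreover have "a \<otimes> b \<in> carrier R" using ab by simp
      ultimately show ?case by auto
    qed
    then have frac: "\<exists>a\<in>carrier R. \<exists>k::nat. x = fraction R a (s [^] k)" if "x \<in> carrier ?K" for x
      using that unfolding gen .
    have "\<exists>c\<in>carrier R. \<exists>k::nat. d \<otimes> c = s [^] k" if d: "d \<in> nz" for d
    proof -
      obtain a and k :: nat where a: "a \<in> carrier R" "fraction R \<one> d = fraction R a (s [^] k)"
        using frac[OF frac_closed[OF one_closed d]] by auto
      then have "\<one> \<otimes> s [^] k = a \<otimes> d" using frac_eq_iff[OF one_closed d a(1) power_in_nz[OF s(1)]] by simp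
      then have "d \<otimes> a = s [^] k" using a(1) d s(1) m_comm by simp
      then show ?thesis using a(1) by auto
    qed
    then show "\<exists>s\<in>nz. \<forall>d\<in>nz. \<exists>c\<in>carrier R. \<exists>k::nat. d \<otimes> c = s [^] k" using s(1) by auto
  next
    assume "\<exists>s\<in>nz. \<forall>d\<in>nz. \<exists>c\<in>carrier R. \<exists>k::nat. d \<otimes> c = s [^] k"
    then obtain s where s: "s \<in> nz" "\<forall>d\<in>nz. \<exists>c\<in>carrier R. \<exists>k::nat. d \<otimes> c = s [^] k" ..
    let ?H = "quotient_field_embed R ` carrier R \<union> {fraction R \<one> s}"
    let ?G = "generate_ring ?K ?H"
    have H: "?H \<subseteq> carrier ?K" using s(1) unfolding quotient_field_embed_def by auto
    have pow: "fraction R \<one> (s [^] k) \<in> ?G" for k :: nat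
    proof (induction k)
      case 0
      then show ?case using generate_ring.one[of ?K ?H] by (simp add: quotient_field_one)
    next
      case (Suc k)
      have "fraction R \<one> s \<in> ?G" by (rule generate_ring.incl) simp
      then have "fraction R \<one> (s [^] k) \<otimes>\<^bsub>?K\<^esub> fraction R \<one> s \<in> ?G"
        by (rule generate_ring.eng_mult[OF Suc])
      then show ?case
        using quotient_field_mult[OF one_closed power_in_nz[OF s(1)] one_closed s(1), of k] by simp
    qed
    have "x \<in> ?G" if x: "x \<in> carrier ?K" for x
    proof -
      obtain a d where ad: "x = fraction R a d" "a \<in> carrier R" "d \<in> nz"
        using x by (auto simp: quotient_field_carrier)
      obtain c and k :: nat where c: "c \<in> carrier R" "d \<otimes> c = s [^] k"
        using bspec[OF s(2) ad(3)] by auto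
      note sk = power_in_nz[OF s(1), of k]
      have "x = fraction R (a \<otimes> c) (s [^] k)"
        unfolding ad(1) using ad c sk by (subst frac_eq_iff) (auto simp: c(2)[symmetric] m_ac)
      also have "\<dots> = fraction R (a \<otimes> c) \<one> \<otimes>\<^bsub>?K\<^esub> fraction R \<one> (s [^] k)"
        using quotient_field_mult[of "a \<otimes> c" \<one> \<one> "s [^] k"] ad c sk by simp
      also have "\<dots> \<in> ?G"
      proof (rule generate_ring.eng_mult[OF _ pow], rule generate_ring.incl)
        show "fraction R (a \<otimes> c) \<one> \<in> ?H" unfolding quotient_field_embed_def using ad c by auto
      qed
      finally show ?thesis .
    qed
    then have "?G = carrier ?K" using K.generate_ring_incl[OF H] by auto
    then show "G_domain R"
      unfolding G_domain_def using H domain_axioms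
      by (intro conjI exI[of _ "{fraction R \<one> s}"]) auto
  }
qed

text \<open>
  If the element \<open>s\<close> inverted to obtain the quotient field is not a unit, then it lies in every
  maximal ideal, so that \<open>1 + s w\<close> is a unit for every \<open>w\<close>. As units are algebraic over the prime
  ring, \<open>s\<close> divides a nonzero integer \<open>k\<close>, and \<open>1 + k\<^sup>2\<close> has a prime factor.
\<close>

lemma field_if_G_domain_not_submaximal:
  assumes G: "G_domain R" and ns: "\<not> submaximal R"
  shows "field R"
proof -
  obtain s where s: "s \<in> nz" and div: "\<And>d. d \<in> nz \<Longrightarrow> \<exists>c\<in>carrier R. \<exists>k::nat. d \<otimes> c = s [^] k"
    using G unfolding G_domain_iff by auto
  have sc: "s \<in> carrier R" "s \<noteq> \<zero>" using s by auto
  have "s \<in> Units R"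
  proof (rule ccontr)
    assume su: "s \<notin> Units R"
    have unit: "\<one> \<oplus> s \<otimes> w \<in> Units R" if w: "w \<in> carrier R" for w
    proof -
      let ?d = "\<one> \<oplus> s \<otimes> w"
      have dc: "?d \<in> carrier R" using sc w by simp
      have d0: "?d \<noteq> \<zero>"
      proof
        assume "?d = \<zero>"
        have "s \<otimes> \<ominus> w = \<one> \<ominus> ?d" using sc w by algebra
        also have "\<dots> = \<one>" unfolding \<open>?d = \<zero>\<close> by simp
        finally show False using UnitsI[of s "\<ominus> w"] sc w su by simp
      qed
      obtain c and k :: nat where "c \<in> carrier R" "?d \<otimes> c = s [^] k"
        using div[of ?d] dc d0 by auto
      then show ?thesis
      proof (induction k arbitrary: c)
        case 0
        then show ?case using UnitsI[OF dc 0(1)] by simp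
      next
        case (Suc k)
        have sk: "s [^] k \<in> carrier R" using sc by simp
        \<comment> \<open>With \<open>d = 1 + s w\<close> and \<open>d c = s^(k+1)\<close> one has
          \<open>d s^k = s^k + w s^(k+1) = s^k + w d c\<close>, so \<open>d\<close> already divides
          \<open>s^k\<close>. The descent ends with \<open>d\<close> dividing
          \<open>1\<close>.\<close>
        have "?d \<otimes> (s [^] k \<ominus> w \<otimes> c) = s [^] k \<oplus> w \<otimes> (s [^] k \<otimes> s) \<ominus> w \<otimes> (?d \<otimes> c)"
          using sc w sk Suc.prems(1) by algebra
        also have "\<dots> = s [^] k"
          unfolding Suc.prems(2) nat_pow_Suc using sc w sk by algebra
        finally show ?case using Suc.IH[of "s [^] k \<ominus> w \<otimes> c"] sk w Suc.prems(1) by simp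
      qed
    qed
    have "root_over prime_subring (\<one> \<oplus> s)"
      using unit_root_over[OF ns subring_prime_subring unit[OF one_closed]] sc by simp
    then have "root_over prime_subring s"
      by (rule root_over_translate[OF subring_prime_subring sc(1)])
    then obtain c w where c: "c \<in> prime_subring" "c \<noteq> \<zero>" "w \<in> carrier R" "c = s \<otimes> w"
      by (rule root_over_dvd_const[OF subring_prime_subring sc])
    have cc: "c \<in> carrier R" by (rule subring_mem_carrier[OF subring_prime_subring c(1)])
    obtain k where k: "c = \<guillemotleft>k\<guillemotright>" using c(1) unfolding prime_subring_def by auto
    show False
    proof (cases "finite prime_subring")
      case True
      \<comment> \<open>A nonzero element of a finite prime ring is a root of unity, and
        \<open>s\<close> divides it, so \<open>s\<close> would be a unit.\<close>
      obtain N :: nat where N: "N > 0" "c [^] N = \<one>"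
        using finite_powers_imp_torsion[OF cc c(2) True]
          subring_nat_pow[OF subring_prime_subring c(1)] by auto
      then have "c \<otimes> c [^] (N - 1) = \<one>" using cc by (metis Suc_diff_1 nat_pow_Suc2)
      then have "s \<otimes> (w \<otimes> c [^] (N - 1)) = \<one>"
        using c(3,4) sc cc m_assoc[of s w "c [^] (N - 1)"] by simp
      then have "s \<in> Units R" using UnitsI[of s "w \<otimes> c [^] (N - 1)"] sc c(3) cc by simp
      then show False using su by simp
    next
      case False
      then have inj: "j = 0" if "\<guillemotleft>j\<guillemotright> = \<zero>" for j using finite_prime_subring that by metis
      \<comment> \<open>The square is taken because \<open>1 + k\<close> can be \<open>0\<close> or
        \<open>-1\<close> for negative \<open>k\<close>, whereas \<open>1 + k * k\<close> exceeds
        \<open>1\<close>. In \<open>R\<close> it is \<open>1 + s (w c)\<close>, hence a unit, and so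
        is its prime factor.\<close>
      have "k \<noteq> 0" using k c(2) by auto
      then have "\<not> is_unit (1 + k * k)"
        by (metis add_cancel_left_right add_le_same_cancel1 mult_eq_0_iff not_square_less_zero
            zdvd1_eq abs_of_nonneg add_nonneg_nonneg zero_le_one zero_le_square)
      moreover have "1 + k * k \<noteq> 0" using zero_le_square[of k] by linarith
      ultimately obtain p where p: "Factorial_Ring.prime p" "p dvd 1 + k * k"
        using prime_divisor_exists by metis
      obtain q where q: "1 + k * k = p * q" using p(2) by (rule dvdE)
      have "\<guillemotleft>p\<guillemotright> \<otimes> \<guillemotleft>q\<guillemotright> = \<one> \<oplus> s \<otimes> (w \<otimes> c)"
        unfolding of_int_mult[symmetric] q[symmetric]
        using k[symmetric] c(3,4) sc cc m_assoc[of s w c] by simp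
      then have "\<guillemotleft>p\<guillemotright> \<otimes> \<guillemotleft>q\<guillemotright> \<in> Units R" using unit[of "w \<otimes> c"] c(3) cc by simp
      then have "\<guillemotleft>p\<guillemotright> \<in> Units R" using unit_factor[of "\<guillemotleft>p\<guillemotright>" "\<guillemotleft>q\<guillemotright>"] by simp
      then show False using prime_not_unit[OF ns inj p(1)] by simp
    qed
  qed
  show ?thesis
  proof (rule cring_fieldI2)
    show "\<zero> \<noteq> \<one>" by simp
    fix a assume "a \<in> carrier R" "a \<noteq> \<zero>"
    then obtain c and k :: nat where c: "c \<in> carrier R" "a \<otimes> c = s [^] k" using div[of a] by auto
    obtain t where t: "t \<in> carrier R" "s \<otimes> t = \<one>" using \<open>s \<in> Units R\<close> unfolding Units_def by auto
    have "s [^] k \<otimes> t [^] k = \<one>" using nat_pow_distrib[OF sc(1) t(1), of k] t(2) by simp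
    then have "a \<otimes> (c \<otimes> t [^] k) = \<one>"
      using c t(1) m_assoc[of a c "t [^] k"] \<open>a \<in> carrier R\<close> by simp
    then show "\<exists>b\<in>carrier R. a \<otimes> b = \<one>" using c(1) t(1) by auto
  qed
qed

end

section \<open>Pulling maximal subrings back along surjections\<close>

lemma (in ring_hom_ring) submaximal_if_image_submaximal:
  assumes surj: "h ` carrier R = carrier S" and sub: "submaximal S"
  shows "submaximal R"
proof -
  obtain V where V: "subring V S" "V \<subset> carrier S"
    and max: "\<not> (\<exists>T. subring T S \<and> V \<subset> T \<and> T \<subset> carrier S)"
    using sub unfolding submaximal_def maximal_subring_def by auto
  let ?T = "{r \<in> carrier R. h r \<in> V}"
  have T: "subring ?T R"
    using subringE(3,5-7)[OF V(1)] by (intro R.subringI) auto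
  have "maximal_subring ?T R"
    unfolding maximal_subring_def
  proof (intro conjI notI T)
    obtain x where x: "x \<in> carrier S" "x \<notin> V" using V(2) by auto
    then have "x \<in> h ` carrier R" using surj by simp
    then show "?T \<subset> carrier R" using x(2) by auto
    assume "\<exists>U. subring U R \<and> ?T \<subset> U \<and> U \<subset> carrier R"
    then obtain U where U: "subring U R" "?T \<subset> U" "U \<subset> carrier R" by auto
    have hU: "subring (h ` U) S" by (rule img_is_subring[OF U(1)])
    have "V \<subseteq> h ` U"
    proof
      fix v assume v: "v \<in> V"
      then have "v \<in> h ` carrier R" using V(2) surj by auto
      then obtain r where "r \<in> carrier R" "v = h r" by auto
      then show "v \<in> h ` U" using v U(2) by auto
    qed
    moreover have "h ` U \<noteq> V" using U by auto
    ultimately have "h ` U = carrier S"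
      using max hU subringE(1)[OF hU] by (metis psubsetI)
    moreover obtain r where r: "r \<in> carrier R" "r \<notin> U" using U(3) by auto
    ultimately obtain u where u: "u \<in> U" "h r = h u" by (metis imageE imageI surj)
    have uc: "u \<in> carrier R" using u U(3) by auto
    \<comment> \<open>Elements with the same image differ by an element of the kernel, and the
      kernel lies in \<open>?T\<close>, hence in \<open>U\<close>.\<close>
    have "h (r \<ominus>\<^bsub>R\<^esub> u) = h r \<ominus>\<^bsub>S\<^esub> h u" using r uc by (simp add: R.minus_eq S.minus_eq)
    also have "\<dots> = \<zero>\<^bsub>S\<^esub>" using u uc by (simp add: S.minus_eq S.r_neg)
    finally have "r \<ominus>\<^bsub>R\<^esub> u \<in> ?T" using r uc subringE(2)[OF V(1)] by simp
    then have "(r \<ominus>\<^bsub>R\<^esub> u) \<oplus>\<^bsub>R\<^esub> u \<in> U" using subringE(7)[OF U(1)] u(1) U(2) by auto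
    moreover have "(r \<ominus>\<^bsub>R\<^esub> u) \<oplus>\<^bsub>R\<^esub> u = r"
      using r uc by (simp add: R.minus_eq R.a_assoc R.l_neg)
    ultimately show False using r by simp
  qed
  then show ?thesis unfolding submaximal_def by auto
qed

section \<open>Residue fields and the prime spectrum\<close>

context cring
begin

lemma quot_carrier_iff: "z \<in> carrier (R Quot I) \<longleftrightarrow> (\<exists>a\<in>carrier R. z = I +> a)"
  by (auto simp: FactRing_def A_RCOSETS_def')

lemma quot_zero_iff:
  assumes "ideal I R" "a \<in> carrier R"
  shows "I +> a = \<zero>\<^bsub>R Quot I\<^esub> \<longleftrightarrow> a \<in> I"
proof -
  have "\<zero>\<^bsub>R Quot I\<^esub> = I +> \<zero>"
    using a_rcos_zero[OF assms(1) additive_subgroup.zero_closed[OF ideal.axioms(1)[OF assms(1)]]]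
    by (simp add: FactRing_def)
  then show ?thesis
    using quotient_eq_iff_same_a_r_cos[OF assms zero_closed] assms(2) by simp
qed

lemma quot_one: "\<one>\<^bsub>R Quot I\<^esub> = I +> \<one>"
  by (simp add: FactRing_def)

lemma quot_mult:
  assumes "ideal I R" "a \<in> carrier R" "b \<in> carrier R"
  shows "(I +> a) \<otimes>\<^bsub>R Quot I\<^esub> (I +> b) = I +> (a \<otimes> b)"
  using ring_hom_mult[OF ideal.rcos_ring_hom[OF assms(1)] assms(2,3)] by simp

lemma submaximal_if_quotient_submaximal:
  assumes "ideal I R" "submaximal (R Quot I)"
  shows "submaximal R"
proof (rule ring_hom_ring.submaximal_if_image_submaximal[OF ideal.rcos_ring_hom_ring[OF assms(1)] _ assms(2)])
  show "(+>) I ` carrier R = carrier (R Quot I)" using quot_carrier_iff by auto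
qed

lemma ideal_minus:
  assumes "ideal I R" "a \<in> I" "b \<in> I" shows "a \<ominus> b \<in> I"
  using assms additive_subgroup.a_closed[OF ideal.axioms(1)[OF assms(1)]]
    additive_subgroup.a_inv_closed[OF ideal.axioms(1)[OF assms(1)]] by (simp add: a_minus_def)

lemma ideal_add:
  assumes "ideal I R" "a \<in> I" "b \<in> I" shows "a \<oplus> b \<in> I"
  using additive_subgroup.a_closed[OF ideal.axioms(1)[OF assms(1)] assms(2,3)] .

lemma quotient_field_imp_maximalideal:
  assumes P: "ideal P R" and F: "field (R Quot P)"
  shows "maximalideal P R"
proof (rule maximalidealI[OF P])
  interpret F: field "R Quot P" by (rule F)
  have one: "\<one> \<notin> P"
    using quot_zero_iff[OF P one_closed] F.one_not_zero unfolding quot_one by simp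
  then show "carrier R \<noteq> P" by auto
  fix J assume J: "ideal J R" "P \<subseteq> J" "J \<subseteq> carrier R"
  show "J = P \<or> J = carrier R"
  proof (cases "J = P")
    case False
    then obtain x where x: "x \<in> J" "x \<notin> P" using J(2) by auto
    have xc: "x \<in> carrier R" using x(1) J(3) by auto
    have "P +> x \<in> Units (R Quot P)"
      using F.field_Units quot_zero_iff[OF P xc] x(2) quot_carrier_iff[of "P +> x" P] xc by auto
    then obtain z where "z \<in> carrier (R Quot P)" "(P +> x) \<otimes>\<^bsub>R Quot P\<^esub> z = \<one>\<^bsub>R Quot P\<^esub>"
      unfolding Units_def by auto
    then obtain y where y: "y \<in> carrier R" "P +> (x \<otimes> y) = P +> \<one>"
      using quot_carrier_iff[of z P] quot_mult[OF P xc] unfolding quot_one by auto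
    have "x \<otimes> y \<ominus> \<one> \<in> P"
      using quotient_eq_iff_same_a_r_cos[OF P m_closed[OF xc y(1)] one_closed] y(2) by simp
    then have 1: "x \<otimes> y \<ominus> \<one> \<in> J" using J(2) by auto
    have "x \<otimes> y \<ominus> (x \<otimes> y \<ominus> \<one>) \<in> J"
      by (rule ideal_minus[OF J(1) ideal.I_r_closed[OF J(1) x(1) y(1)] 1])
    moreover have "x \<otimes> y \<ominus> (x \<otimes> y \<ominus> \<one>) = \<one>" using xc y(1) by algebra
    ultimately show ?thesis using ideal.one_imp_carrier[OF J(1)] by simp
  qed simp
qed

text \<open>A maximal subring of \<open>R Quot P\<close> would pull back to \<open>R\<close>; so a
  quotient that is a G-domain is a field.\<close>

lemma Hilbert_if_not_submaximal:
  assumes ns: "\<not> submaximal R"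
  shows "Hilbert_ring R"
  unfolding Hilbert_ring_def
proof (intro allI impI)
  fix P assume "G_ideal P R"
  then have P: "primeideal P R" and G: "G_domain (R Quot P)" unfolding G_ideal_def by auto
  have I: "ideal P R" by (rule primeideal.axioms(1)[OF P])
  have "field (R Quot P)"
    using domain.field_if_G_domain_not_submaximal[OF primeideal.quotient_is_domain[OF P] G]
      submaximal_if_quotient_submaximal[OF I] ns by auto
  then show "maximalideal P R" by (rule quotient_field_imp_maximalideal[OF I])
qed

section \<open>Residue fields at maximal ideals\<close>

lemma maximalideal_inverse:
  assumes M: "maximalideal M R" and x: "x \<in> carrier R" "x \<notin> M"
  obtains w where "w \<in> carrier R" "\<one> \<ominus> x \<otimes> w \<in> M"
proof -
  interpret F: field "R Quot M" by (rule maximalideal.quotient_is_field[OF M is_cring])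
  have I: "ideal M R" by (rule maximalideal.axioms(1)[OF M])
  have "M +> x \<in> Units (R Quot M)"
    using F.field_Units quot_zero_iff[OF I x(1)] x quot_carrier_iff[of "M +> x" M] by auto
  then obtain z where "z \<in> carrier (R Quot M)" "(M +> x) \<otimes>\<^bsub>R Quot M\<^esub> z = \<one>\<^bsub>R Quot M\<^esub>"
    unfolding Units_def by auto
  then obtain w where w: "w \<in> carrier R" "M +> \<one> = M +> (x \<otimes> w)"
    using quot_carrier_iff[of z M] quot_mult[OF I x(1)] unfolding quot_one by auto
  then have "\<one> \<ominus> x \<otimes> w \<in> M"
    using quotient_eq_iff_same_a_r_cos[OF I one_closed m_closed[OF x(1) w(1)]] by simp
  then show ?thesis by (rule that[OF w(1)])
qed

text \<open>A sequence of representatives for the residue classes of \<open>M\<close>. Repetitions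
  are allowed, so that finite and infinite residue fields share the index set
  \<open>nat\<close>.\<close>

definition enumerates :: "(nat \<Rightarrow> 'a) \<Rightarrow> 'a set \<Rightarrow> bool" where
  "enumerates e M \<longleftrightarrow> range e \<subseteq> carrier R \<and> (\<forall>r\<in>carrier R. \<exists>i. r \<ominus> e i \<in> M)"

lemma ex_enumerates:
  assumes ns: "\<not> submaximal R" and M: "maximalideal M R"
  shows "\<exists>e. enumerates e M"
proof -
  let ?Q = "R Quot M"
  have I: "ideal M R" by (rule maximalideal.axioms(1)[OF M])
  interpret F: field ?Q by (rule maximalideal.quotient_is_field[OF M is_cring])
  have "countable (carrier ?Q)"
    using F.countable_if_not_submaximal submaximal_if_quotient_submaximal[OF I] ns by auto
  then have Q: "range (from_nat_into (carrier ?Q)) = carrier ?Q"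
    using range_from_nat_into F.carrier_not_empty by metis
  have "\<forall>i. \<exists>a\<in>carrier R. from_nat_into (carrier ?Q) i = M +> a"
    using Q quot_carrier_iff[of _ M] by auto
  then obtain e where e: "\<And>i. e i \<in> carrier R" "\<And>i. from_nat_into (carrier ?Q) i = M +> e i"
    by metis
  have "\<exists>i. r \<ominus> e i \<in> M" if r: "r \<in> carrier R" for r
  proof -
    have "M +> r \<in> carrier ?Q" using quot_carrier_iff r by auto
    then have "M +> r \<in> range (from_nat_into (carrier ?Q))" unfolding Q .
    then obtain i where "M +> r = M +> e i" using e(2) by auto
    then show ?thesis using quotient_eq_iff_same_a_r_cos[OF I r e(1)] by auto
  qed
  then show ?thesis unfolding enumerates_def using e(1) by auto
qed

text \<open>
  The operation tables of \<open>R/M\<close> with respect to an enumeration of representatives. They determine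
  the countable field \<open>R/M\<close> up to isomorphism.
\<close>

definition table :: "(nat \<Rightarrow> 'a) \<Rightarrow> 'a set \<Rightarrow> (nat \<times> nat \<times> nat \<times> nat) set" where
  "table e M =
     {(0, i, j, k) | i j k. e i \<ominus> e j \<ominus> e k \<in> M} \<union>
     {(1, i, j, k) | i j k. e k \<ominus> e i \<otimes> e j \<in> M} \<union>
     {(2, i, 0, 0) | i. \<one> \<ominus> e i \<in> M}"

lemma table_iff:
  "(0, i, j, k) \<in> table e M \<longleftrightarrow> e i \<ominus> e j \<ominus> e k \<in> M"
  "(1, i, j, k) \<in> table e M \<longleftrightarrow> e k \<ominus> e i \<otimes> e j \<in> M"
  "(2, i, 0, 0) \<in> table e M \<longleftrightarrow> \<one> \<ominus> e i \<in> M"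
  unfolding table_def by auto

lemma subringI_minus:
  assumes "S \<subseteq> carrier R" "\<one> \<in> S"
    and minus: "\<And>x y. x \<in> S \<Longrightarrow> y \<in> S \<Longrightarrow> x \<ominus> y \<in> S"
    and mult: "\<And>x y. x \<in> S \<Longrightarrow> y \<in> S \<Longrightarrow> x \<otimes> y \<in> S"
  shows "subring S R"
proof (rule subringI[OF assms(1,2)])
  have zero: "\<zero> \<in> S" using minus[OF assms(2,2)] by (simp add: a_minus_def r_neg)
  show neg: "\<ominus> h \<in> S" if "h \<in> S" for h
    using minus[OF zero that] that assms(1) by (auto simp: a_minus_def)
  show "h \<otimes> k \<in> S" if "h \<in> S" "k \<in> S" for h k by (rule mult[OF that])
  show "h \<oplus> k \<in> S" if "h \<in> S" "k \<in> S" for h k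
  proof -
    have "h \<in> carrier R" "k \<in> carrier R" using that assms(1) by auto
    then have "h \<ominus> \<ominus> k = h \<oplus> k" by (simp add: a_minus_def)
    then show ?thesis using minus[OF that(1) neg[OF that(2)]] by simp
  qed
qed

text \<open>
  Equal tables give an isomorphism between the residue fields; the elements whose two residues
  correspond form the preimage of the diagonal, a maximal subring of \<open>R/M \<times> R/N\<close>.
\<close>

lemma submaximal_if_same_table:
  assumes M: "maximalideal M R" and N: "maximalideal N R" and "M \<noteq> N"
    and e: "enumerates e M" and f: "enumerates f N" and tab: "table e M = table f N"
  shows "submaximal R"
proof -
  have IM: "ideal M R" and IN: "ideal N R"
    using maximalideal.axioms(1)[OF M] maximalideal.axioms(1)[OF N] by simp_all
  have cM: "a \<in> carrier R" if "a \<in> M" for a by (rule ideal.Icarr[OF IM that])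
  have cN: "a \<in> carrier R" if "a \<in> N" for a by (rule ideal.Icarr[OF IN that])
  have ce [simp]: "e i \<in> carrier R" "f i \<in> carrier R" for i
    using e f unfolding enumerates_def by auto
  have eM: "\<exists>i. r \<ominus> e i \<in> M" and fN: "\<exists>i. r \<ominus> f i \<in> N" if "r \<in> carrier R" for r
    using that e f unfolding enumerates_def by auto
  have sub: "e i \<ominus> e j \<ominus> e k \<in> M \<longleftrightarrow> f i \<ominus> f j \<ominus> f k \<in> N"
    and mult: "e k \<ominus> e i \<otimes> e j \<in> M \<longleftrightarrow> f k \<ominus> f i \<otimes> f j \<in> N"
    and one: "\<one> \<ominus> e i \<in> M \<longleftrightarrow> \<one> \<ominus> f i \<in> N" for i j k
    using tab table_iff(1)[of i j k e M] table_iff(1)[of i j k f N] table_iff(2)[of i j k e M]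
      table_iff(2)[of i j k f N] table_iff(3)[of i e M] table_iff(3)[of i f N] by simp_all
  have neg: "\<ominus> a \<in> I \<longleftrightarrow> a \<in> I" if "ideal I R" "a \<in> carrier R" for I a
    using additive_subgroup.a_inv_closed[OF ideal.axioms(1)[OF that(1)]] that(2)
    by (metis minus_minus)
  have zero: "e i \<in> M \<longleftrightarrow> f i \<in> N" for i
  proof -
    \<comment> \<open>The subtraction table recognises zero, as the residue \<open>a\<close> with
      \<open>a - a = a\<close>.\<close>
    have "e i \<ominus> e i \<ominus> e i = \<ominus> e i" "f i \<ominus> f i \<ominus> f i = \<ominus> f i"
      by (simp_all add: a_minus_def r_neg)
    then show ?thesis using sub[of i i i] neg[OF IM ce(1), of i] neg[OF IN ce(2), of i] by simp
  qed
  \<comment> \<open>The residue of \<open>x\<close> is zero modulo \<open>M\<close> and nonzero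
    modulo \<open>N\<close>, so \<open>x\<close> is off the diagonal and can serve as the generator
    over \<open>S\<close>. With \<open>w\<close> an inverse modulo \<open>N\<close>, the product
    \<open>x \<otimes> w\<close> has residues \<open>0\<close> and \<open>1\<close>.\<close>
  obtain x where x: "x \<in> M" "x \<notin> N"
    using maximalideal.I_maximal[OF M IN] maximalideal.I_notcarr[OF N] \<open>M \<noteq> N\<close> cN by blast
  have xc: "x \<in> carrier R" by (rule cM[OF x(1)])
  obtain w where w: "w \<in> carrier R" "\<one> \<ominus> x \<otimes> w \<in> N"
    by (rule maximalideal_inverse[OF N xc x(2)])
  define S where "S = {r \<in> carrier R. \<exists>i. r \<ominus> e i \<in> M \<and> r \<ominus> f i \<in> N}"
  have SI: "r \<in> S" if "r \<in> carrier R" "r \<ominus> e i \<in> M" "r \<ominus> f i \<in> N" for r i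
    using that unfolding S_def by auto
  have S: "subring S R"
  proof (rule subringI_minus)
    show "S \<subseteq> carrier R" unfolding S_def by auto
    show "\<one> \<in> S" using eM[OF one_closed] one SI[OF one_closed] by auto
  next
    fix r s assume "r \<in> S" "s \<in> S"
    then obtain i j where rs: "r \<in> carrier R" "s \<in> carrier R"
      and i: "r \<ominus> e i \<in> M" "r \<ominus> f i \<in> N" and j: "s \<ominus> e j \<in> M" "s \<ominus> f j \<in> N"
      unfolding S_def by auto
    show "r \<ominus> s \<in> S"
    proof -
      obtain k where k: "e i \<ominus> e j \<ominus> e k \<in> M" using eM[of "e i \<ominus> e j"] by auto
      \<comment> \<open>Stated for any sequence \<open>a\<close>, to be used for \<open>e\<close>
        modulo \<open>M\<close> and for \<open>f\<close> modulo \<open>N\<close>; equality of the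
        tables lets the same index \<open>k\<close> serve both.\<close>
      have *: "r \<ominus> s \<ominus> a k = (r \<ominus> a i) \<ominus> (s \<ominus> a j) \<oplus> (a i \<ominus> a j \<ominus> a k)"
        if a: "a i \<in> carrier R" "a j \<in> carrier R" "a k \<in> carrier R" for a
        using rs a by algebra
      have "r \<ominus> s \<ominus> e k \<in> M"
        unfolding *[of e, OF ce(1) ce(1) ce(1)]
        by (rule ideal_add[OF IM ideal_minus[OF IM i(1) j(1)] k])
      moreover have "r \<ominus> s \<ominus> f k \<in> N"
        unfolding *[of f, OF ce(2) ce(2) ce(2)]
        by (rule ideal_add[OF IN ideal_minus[OF IN i(2) j(2)] k[unfolded sub]])
      ultimately show ?thesis using SI rs by simp
    qed
    show "r \<otimes> s \<in> S"
    proof -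
      obtain k where k': "e i \<otimes> e j \<ominus> e k \<in> M" using eM[of "e i \<otimes> e j"] by auto
      have "\<ominus> (e i \<otimes> e j \<ominus> e k) = e k \<ominus> e i \<otimes> e j" using ce(1)[of i] ce(1)[of j] ce(1)[of k] by algebra
      then have k: "e k \<ominus> e i \<otimes> e j \<in> M" using neg[OF IM, of "e i \<otimes> e j \<ominus> e k"] k' by simp
      have *: "r \<otimes> s \<ominus> a k = s \<otimes> (r \<ominus> a i) \<oplus> a i \<otimes> (s \<ominus> a j) \<ominus> (a k \<ominus> a i \<otimes> a j)"
        if a: "a i \<in> carrier R" "a j \<in> carrier R" "a k \<in> carrier R" for a
        using rs a by algebra
      have "r \<otimes> s \<ominus> e k \<in> M"
        unfolding *[of e, OF ce(1) ce(1) ce(1)]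
        by (intro ideal_minus[OF IM] ideal_add[OF IM] k ideal.I_l_closed[OF IM] i(1) j(1) rs(2) ce(1))
      moreover have "r \<otimes> s \<ominus> f k \<in> N"
        unfolding *[of f, OF ce(2) ce(2) ce(2)]
        by (intro ideal_minus[OF IN] ideal_add[OF IN] k[unfolded mult] ideal.I_l_closed[OF IN]
            i(2) j(2) rs(2) ce(2))
      ultimately show ?thesis using SI rs by simp
    qed
  qed
  have "x \<notin> S"
  proof
    assume "x \<in> S"
    then obtain i where i: "x \<ominus> e i \<in> M" "x \<ominus> f i \<in> N" unfolding S_def by auto
    have 1: "x \<ominus> (x \<ominus> a) = a" "(x \<ominus> a) \<oplus> a = x" if "a \<in> carrier R" for a
      using xc that by algebra+
    have "e i \<in> M" using ideal_minus[OF IM x(1) i(1)] 1(1)[OF ce(1)] by simp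
    then have fi: "f i \<in> N" using zero by simp
    have "x \<in> N" using ideal_add[OF IN i(2) fi] 1(2)[OF ce(2)] by simp
    then show False using x(2) by simp
  qed
  have crt: "\<exists>r\<in>S. r \<ominus> e i \<in> M \<and> r \<ominus> f i \<in> N" for i
  proof -
    let ?p = "x \<otimes> w"
    let ?q = "\<one> \<ominus> ?p"
    have p: "?p \<in> M" by (rule ideal.I_r_closed[OF IM x(1) w(1)])
    \<comment> \<open>Chinese remainder interpolation: \<open>?q\<close> has residues
      \<open>1\<close> and \<open>0\<close>, \<open>?p\<close> has residues \<open>0\<close> and
      \<open>1\<close>. It follows that \<open>S\<close> maps onto both residue fields.\<close>
    let ?r = "e i \<otimes> ?q \<oplus> f i \<otimes> ?p"
    have "?r \<ominus> e i = (f i \<ominus> e i) \<otimes> ?p" "?r \<ominus> f i = (e i \<ominus> f i) \<otimes> ?q"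
      using xc w(1) ce[of i] by algebra+
    then have "?r \<ominus> e i \<in> M" "?r \<ominus> f i \<in> N"
      using ideal.I_l_closed[OF IM p, of "f i \<ominus> e i"] ideal.I_l_closed[OF IN w(2), of "e i \<ominus> f i"]
      by simp_all
    moreover have "?r \<in> carrier R" using xc w(1) by simp
    ultimately show ?thesis using SI by blast
  qed
  have approx: "\<exists>s\<in>S. y \<ominus> s \<in> M" "\<exists>s\<in>S. y \<ominus> s \<in> N" if y: "y \<in> carrier R" for y
  proof -
    have *: "y \<ominus> s = (y \<ominus> a) \<ominus> (s \<ominus> a)" if "s \<in> carrier R" "a \<in> carrier R" for s a
      using y that by algebra
    show "\<exists>s\<in>S. y \<ominus> s \<in> M"
    proof -
      obtain i where i: "y \<ominus> e i \<in> M" using eM[OF y] ..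
      obtain r where r: "r \<in> S" "r \<ominus> e i \<in> M" using crt[of i] by auto
      have "y \<ominus> r \<in> M"
        using *[OF subring_mem_carrier[OF S r(1)] ce(1)[of i]] ideal_minus[OF IM i r(2)] by simp
      then show ?thesis using r(1) by (rule bexI)
    qed
    show "\<exists>s\<in>S. y \<ominus> s \<in> N"
    proof -
      obtain i where i: "y \<ominus> f i \<in> N" using fN[OF y] ..
      obtain r where r: "r \<in> S" "r \<ominus> f i \<in> N" using crt[of i] by auto
      have "y \<ominus> r \<in> N"
        using *[OF subring_mem_carrier[OF S r(1)] ce(2)[of i]] ideal_minus[OF IN i r(2)] by simp
      then show ?thesis using r(1) by (rule bexI)
    qed
  qed
  have MN: "y \<in> S" if y: "y \<in> M" "y \<in> N" for y
  proof -
    obtain i where "\<zero> \<ominus> e i \<in> M" using eM[OF zero_closed] ..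
    then have ei: "e i \<in> M" using neg[OF IM ce(1)] by (simp add: a_minus_def)
    then have fi: "f i \<in> N" using zero by simp
    show ?thesis
      by (rule SI[OF cM[OF y(1)] ideal_minus[OF IM y(1) ei] ideal_minus[OF IN y(2) fi]])
  qed
  show ?thesis
  proof (rule submaximal_if_generated[OF S xc \<open>x \<notin> S\<close>])
    fix T assume T: "subring T R" "S \<subseteq> T" "x \<in> T"
    have sum: "y \<in> T" if "y \<in> carrier R" "t \<in> T" "y \<ominus> t \<in> T" for y t
    proof -
      have "(y \<ominus> t) \<oplus> t = y"
        using that(1) subring_mem_carrier[OF T(1) that(2)] by algebra
      then show ?thesis using subringE(7)[OF T(1) that(3,2)] by simp
    qed
    have MT: "y \<in> T" if y: "y \<in> M" for y
    proof -
      have yc: "y \<in> carrier R" by (rule cM[OF y])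
      \<comment> \<open>Modulo \<open>N\<close>, \<open>s\<close> agrees with \<open>y w\<close>, so
        \<open>s x\<close> agrees with \<open>y w x\<close>, that is, with \<open>y\<close>. Modulo
        \<open>M\<close>, both \<open>y\<close> and \<open>s x\<close> vanish. Their difference thus
        lies in both ideals, and hence in \<open>S\<close>.\<close>
      obtain s where s: "s \<in> S" "y \<otimes> w \<ominus> s \<in> N" using approx(2)[of "y \<otimes> w"] yc w(1) by auto
      have sc: "s \<in> carrier R" by (rule subring_mem_carrier[OF S s(1)])
      have "y \<ominus> s \<otimes> x = y \<otimes> (\<one> \<ominus> x \<otimes> w) \<oplus> x \<otimes> (y \<otimes> w \<ominus> s)"
        using yc sc xc w(1) by algebra
      then have "y \<ominus> s \<otimes> x \<in> N"
        using ideal_add[OF IN ideal.I_l_closed[OF IN w(2) yc] ideal.I_l_closed[OF IN s(2) xc]] by simp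
      moreover have "y \<ominus> s \<otimes> x \<in> M"
        by (rule ideal_minus[OF IM y ideal.I_l_closed[OF IM x(1) sc]])
      ultimately have "y \<ominus> s \<otimes> x \<in> T" using MN T(2) by auto
      moreover have "s \<otimes> x \<in> T" using subringE(6)[OF T(1)] s(1) T(2,3) by auto
      ultimately show ?thesis using sum[OF yc] by simp
    qed
    have "y \<in> T" if y: "y \<in> carrier R" for y
    proof -
      obtain s where s: "s \<in> S" "y \<ominus> s \<in> M" using approx(1)[OF y] by auto
      show ?thesis using sum[OF y _ MT[OF s(2)]] s(1) T(2) by auto
    qed
    then show "T = carrier R" using subringE(1)[OF T(1)] by auto
  qed
qed

section \<open>Prime ideals as intersections of maximal ideals\<close>

lemma prime_avoiding_powers:
  assumes P: "primeideal P R" and a: "a \<in> carrier R" "a \<notin> P"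
  obtains Q where "primeideal Q R" "P \<subseteq> Q" "a \<notin> Q"
    "\<And>x. x \<in> carrier R \<Longrightarrow> x \<notin> Q \<Longrightarrow> \<exists>n::nat. \<exists>q\<in>Q. \<exists>r\<in>carrier R. a [^] n = q \<oplus> r \<otimes> x"
proof -
  have IP: "ideal P R" by (rule primeideal.axioms(1)[OF P])
  \<comment> \<open>An ideal maximal in this family does double duty: adding any \<open>x\<close>
    outside it captures a power of \<open>a\<close>, which is the last claim of the lemma and,
    applied to two elements, also shows that the ideal is prime.\<close>
  let ?F = "{I. ideal I R \<and> P \<subseteq> I \<and> (\<forall>n::nat. a [^] n \<notin> I)}"
  have "\<exists>Q\<in>?F. \<forall>J\<in>?F. Q \<subseteq> J \<longrightarrow> J = Q"
  proof (rule subset_Zorn_nonempty)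
    have "a [^] n \<notin> P" for n :: nat
    proof (induction n)
      case 0
      have "\<one> \<notin> P"
        using ideal.one_imp_carrier[OF IP] primeideal.I_notcarr[OF P] by auto
      then show ?case by simp
    next
      case (Suc n)
      then show ?case using primeideal.I_prime[OF P, of "a [^] n" a] a by auto
    qed
    then show "?F \<noteq> {}" using IP by auto
    fix C assume C: "C \<noteq> {}" "subset.chain ?F C"
    then have "subset.chain {I. ideal I R} C" by (auto simp: subset_chain_def)
    then have "ideal (\<Union>C) R" using chain_Union_is_ideal[of C] C(1) by simp
    moreover obtain I where "I \<in> C" "P \<subseteq> I" using C by (auto simp: subset_chain_def)
    then have "P \<subseteq> \<Union>C" by auto
    moreover have "\<forall>n::nat. a [^] n \<notin> \<Union>C" using C(2) by (auto simp: subset_chain_def)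
    ultimately show "\<Union>C \<in> ?F" by simp
  qed
  then obtain Q where Q': "Q \<in> ?F" "\<forall>J\<in>?F. Q \<subseteq> J \<longrightarrow> J = Q" ..
  then have IQ: "ideal Q R" and PQ: "P \<subseteq> Q" and aQ: "\<And>n::nat. a [^] n \<notin> Q"
    by auto
  have max: "\<exists>n::nat. a [^] n \<in> J" if J: "ideal J R" "Q \<subseteq> J" "J \<noteq> Q" for J
  proof (rule ccontr)
    assume "\<not> ?thesis"
    then have "J \<in> ?F" using J(1,2) PQ by auto
    then show False using Q'(2) J(2,3) by simp
  qed
  have cQ: "q \<in> carrier R" if "q \<in> Q" for q by (rule ideal.Icarr[OF IQ that])
  have ex: "\<exists>n::nat. \<exists>q\<in>Q. \<exists>r\<in>carrier R. a [^] n = q \<oplus> r \<otimes> x"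
    if x: "x \<in> carrier R" "x \<notin> Q" for x
  proof -
    let ?J = "Q <+>\<^bsub>R\<^esub> PIdl x"
    have J: "z \<in> ?J \<longleftrightarrow> (\<exists>q\<in>Q. \<exists>r\<in>carrier R. z = q \<oplus> r \<otimes> x)" for z
      unfolding set_add_def' cgenideal_def by auto
    have "q \<in> ?J" if "q \<in> Q" for q
      unfolding J using that x cQ[OF that] by (intro bexI[of _ q] bexI[of _ \<zero>]) auto
    moreover have "x = \<zero> \<oplus> \<one> \<otimes> x" using x by simp
    then have "x \<in> ?J"
      unfolding J using additive_subgroup.zero_closed[OF ideal.axioms(1)[OF IQ]] by blast
    ultimately have "\<exists>n::nat. a [^] n \<in> ?J"
      using max[OF add_ideals[OF IQ cgenideal_ideal[OF x(1)]]] x(2) by blast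
    then show ?thesis unfolding J .
  qed
  have "primeideal Q R"
  proof (rule primeidealI[OF IQ is_cring])
    show "carrier R \<noteq> Q" using aQ[of 0] by auto
    fix x y assume x: "x \<in> carrier R" and y: "y \<in> carrier R" and xy: "x \<otimes> y \<in> Q"
    show "x \<in> Q \<or> y \<in> Q"
    proof (rule ccontr)
      assume "\<not> (x \<in> Q \<or> y \<in> Q)"
      then obtain m n :: nat and q r q' r' where *: "q \<in> Q" "r \<in> carrier R" "a [^] m = q \<oplus> r \<otimes> x"
        "q' \<in> Q" "r' \<in> carrier R" "a [^] n = q' \<oplus> r' \<otimes> y"
        using ex[OF x] ex[OF y] by auto
      have "a [^] (m + n) = (q \<oplus> r \<otimes> x) \<otimes> (q' \<oplus> r' \<otimes> y)"
        using *(3,6) a(1) by (simp add: nat_pow_mult[symmetric])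
      also have "\<dots> = (q' \<oplus> r' \<otimes> y) \<otimes> q \<oplus> (r \<otimes> x) \<otimes> q' \<oplus> (r \<otimes> r') \<otimes> (x \<otimes> y)"
        using cQ[OF *(1)] cQ[OF *(4)] *(2,5) x y by algebra
      also have "\<dots> \<in> Q"
        using cQ[OF *(4)] *(2,5) x y
        by (intro ideal_add[OF IQ] ideal.I_l_closed[OF IQ] *(1,4) xy) simp_all
      finally show False using aQ by simp
    qed
  qed
  moreover have "a \<notin> Q" using aQ[of 1] a(1) by simp
  ultimately show ?thesis using that[OF _ PQ] ex by simp
qed

text \<open>Let \<open>Q\<close> be maximal among the ideals above \<open>P\<close> that avoid all
  powers of \<open>a\<close>. In \<open>R Quot Q\<close> every nonzero class divides a power of the
  class of \<open>a\<close>, so \<open>Q\<close> is a G-ideal, and the Hilbert property makes it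
  maximal.\<close>

lemma Hilbert_ring_maximalideal_avoiding:
  assumes H: "Hilbert_ring R" and P: "primeideal P R" and a: "a \<in> carrier R" "a \<notin> P"
  shows "\<exists>M. maximalideal M R \<and> P \<subseteq> M \<and> a \<notin> M"
proof -
  obtain Q where Q: "primeideal Q R" "P \<subseteq> Q" "a \<notin> Q" and
    ex: "\<And>x. x \<in> carrier R \<Longrightarrow> x \<notin> Q \<Longrightarrow> \<exists>n::nat. \<exists>q\<in>Q. \<exists>r\<in>carrier R. a [^] n = q \<oplus> r \<otimes> x"
    using prime_avoiding_powers[OF P a] by metis
  have IQ: "ideal Q R" by (rule primeideal.axioms(1)[OF Q(1)])
  let ?D = "R Quot Q"
  interpret D: domain ?D by (rule primeideal.quotient_is_domain[OF Q(1)])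
  have pow: "(Q +> a) [^]\<^bsub>?D\<^esub> (n::nat) = Q +> (a [^] n)" for n
    by (induction n) (simp_all add: quot_one quot_mult[OF IQ] a(1))
  have s: "Q +> a \<in> D.nz"
    using quot_zero_iff[OF IQ a(1)] Q(3) quot_carrier_iff[of "Q +> a" Q] a(1) by auto
  have "\<exists>c\<in>carrier ?D. \<exists>k::nat. d \<otimes>\<^bsub>?D\<^esub> c = (Q +> a) [^]\<^bsub>?D\<^esub> k" if d: "d \<in> D.nz" for d
  proof -
    obtain x where x: "x \<in> carrier R" "d = Q +> x" using d quot_carrier_iff[of d Q] by auto
    then have "x \<notin> Q" using d quot_zero_iff[OF IQ x(1)] by auto
    then obtain n :: nat and q r where q: "q \<in> Q" "r \<in> carrier R" "a [^] n = q \<oplus> r \<otimes> x"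
      using ex[OF x(1)] by auto
    have qc: "q \<in> carrier R" by (rule ideal.Icarr[OF IQ q(1)])
    have "a [^] n \<ominus> x \<otimes> r = q" unfolding q(3) using qc q(2) x(1) by algebra
    then have "Q +> (a [^] n) = Q +> (x \<otimes> r)"
      using quotient_eq_iff_same_a_r_cos[OF IQ, of "a [^] n" "x \<otimes> r"] q(1,2) x(1) a(1) by simp
    then have "d \<otimes>\<^bsub>?D\<^esub> (Q +> r) = (Q +> a) [^]\<^bsub>?D\<^esub> n"
      unfolding pow x(2) using quot_mult[OF IQ x(1) q(2)] by simp
    moreover have "Q +> r \<in> carrier ?D" using quot_carrier_iff q(2) by auto
    ultimately show ?thesis by auto
  qed
  then have "G_domain ?D" unfolding D.G_domain_iff by (intro bexI[OF _ s] ballI)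
  then have "maximalideal Q R"
    using H Q(1) unfolding Hilbert_ring_def G_ideal_def by simp
  then show ?thesis using Q by auto
qed

text \<open>One power set holds the tables, coded as sets of numbers; the other holds, for each
  prime ideal, the set of codes of the maximal ideals above it. Distinct maximal ideals have
  distinct codes, so this set recovers the prime ideal.\<close>

lemma Spec_lepoll_if_not_submaximal:
  assumes ns: "\<not> submaximal R"
  shows "Spec R \<lesssim> Pow (Pow (UNIV :: nat set))"
proof -
  \<comment> \<open>The choice is meaningful for maximal ideals, and only these are coded in
    \<open>F\<close>.\<close>
  define e where "e M = (SOME e. enumerates e M)" for M
  have e: "enumerates (e M) M" if "maximalideal M R" for M
    unfolding e_def by (rule someI_ex[OF ex_enumerates[OF ns that]])
  define code :: "'a set \<Rightarrow> nat set" where "code M = to_nat ` table (e M) M" for M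
  have code: "M = N" if MN: "maximalideal M R" "maximalideal N R" and "code M = code N" for M N
  proof (rule ccontr)
    assume "M \<noteq> N"
    have "table (e M) M = table (e N) N"
      using \<open>code M = code N\<close> unfolding code_def by (simp add: inj_image_eq_iff)
    then show False
      using submaximal_if_same_table[OF MN \<open>M \<noteq> N\<close> e[OF MN(1)] e[OF MN(2)]] ns by simp
  qed
  define F where "F P = code ` {M. maximalideal M R \<and> P \<subseteq> M}" for P
  have le: "Q \<subseteq> P" if P: "primeideal P R" and Q: "primeideal Q R" and F: "F P = F Q" for P Q
  proof
    fix a assume a: "a \<in> Q"
    show "a \<in> P"
    proof (rule ccontr)
      assume "a \<notin> P"
      moreover have "a \<in> carrier R" by (rule ideal.Icarr[OF primeideal.axioms(1)[OF Q] a])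
      ultimately obtain M where M: "maximalideal M R" "P \<subseteq> M" "a \<notin> M"
        using Hilbert_ring_maximalideal_avoiding[OF Hilbert_if_not_submaximal[OF ns] P] by auto
      then have "code M \<in> F Q" unfolding F[symmetric] unfolding F_def by auto
      then obtain N where "maximalideal N R" "Q \<subseteq> N" "code M = code N" unfolding F_def by auto
      then show False using code[OF M(1)] M(3) a by auto
    qed
  qed
  have "inj_on F (Spec R)"
  proof (rule inj_onI)
    fix P Q assume "P \<in> Spec R" "Q \<in> Spec R" "F P = F Q"
    then show "P = Q" using le[of P Q] le[of Q P] unfolding Spec_def by auto
  qed
  then show ?thesis unfolding lepoll_def by (intro exI[of _ F]) auto
qed

end

theorem corollary1p22:
  fixes R :: "('a, 'b) ring_scheme"
  assumes "cring R"
    and "\<one>\<^bsub>R\<^esub> \<noteq> \<zero>\<^bsub>R\<^esub>"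
  shows "submaximal R \<or> (Hilbert_ring R \<and> Spec R \<lesssim> Pow (Pow (UNIV :: nat set)))"
  using cring.Hilbert_if_not_submaximal[OF assms(1)]
    cring.Spec_lepoll_if_not_submaximal[OF assms(1)] by auto

end
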